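(* Let $n\ge 3$ and let $V=\{v_1,\dots,v_n\}\subset S^2$ be a configuration of $n$ unit vectors in general position. Then the number of crossings $\operatorname{cr}(V)$ of the spherical arc drawing of $K_n$ determined by $V$ satisfies \[ \operatorname{cr}(V)\ \ge\ \frac14\Big\lfloor \frac n2\Big\rfloor\Big\lfloor \frac{n-1}2\Big\rfloor\Big\lfloor \frac{n-2}2\Big\rfloor\Big\lfloor \frac{n-3}2\Big\rfloor . \] Moreover, equality holds if $V$ is coneighborly.
   Context: $S^2$ is the unit sphere in $\mathbb{R}^3$. $V$ is in general position if any $3$ of its vectors are linearly independent (in particular no two are antipodal). The spherical arc drawing of $K_n$ given by $V$ connects each pair $v_i,v_j$ by the unique shortest great-circle arc between them in $S^2$; $\operatorname{cr}(V)$ is the number of crossings in this drawing (pairs of arcs, with four distinct endpoints, that intersect). $V$ is coneighborly if every open linear halfspace of $\mathbb{R}^3$ (bounded by a plane through the origin) contains at least $\lfloor (n-2)/2\rfloor$ vectors of $V$. *)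

theory Defs
  imports "HOL-Analysis.Analysis"
begin

definition general_position :: "(real^3) set \<Rightarrow> bool" where
  "general_position V \<longleftrightarrow> (\<forall>T\<subseteq>V. card T = 3 \<longrightarrow> independent T)"

text \<open>\<open>A\<close> is the point set of a great-circle arc of length \<open>L\<close> from \<open>u\<close> to \<open>v\<close>: it leaves \<open>u\<close> in
  the unit tangent direction \<open>e\<close> and is traversed at unit speed.\<close>

definition great_circle_arc :: "real^3 \<Rightarrow> real^3 \<Rightarrow> real \<Rightarrow> (real^3) set \<Rightarrow> bool" where
  "great_circle_arc u v L A \<longleftrightarrow>
     0 \<le> L \<and> L < 2 * pi \<and>
     (\<exists>e. norm e = 1 \<and> u \<bullet> e = 0 \<and> v = cos L *\<^sub>R u + sin L *\<^sub>R e \<and>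
          A = (\<lambda>t. cos t *\<^sub>R u + sin t *\<^sub>R e) ` {0..L})"

definition shortest_great_circle_arc :: "real^3 \<Rightarrow> real^3 \<Rightarrow> (real^3) set \<Rightarrow> bool" where
  "shortest_great_circle_arc u v A \<longleftrightarrow>
     (\<exists>L. great_circle_arc u v L A \<and> (\<forall>L' A'. great_circle_arc u v L' A' \<longrightarrow> L \<le> L'))"

definition spherical_arc :: "real^3 \<Rightarrow> real^3 \<Rightarrow> (real^3) set" where
  "spherical_arc u v = (THE A. shortest_great_circle_arc u v A)"

lemma ex1_shortest_great_circle_arc:
  assumes u: "norm u = 1" and v: "norm v = 1" and "u \<noteq> v" and "u \<noteq> - v"
  shows "\<exists>!A. shortest_great_circle_arc u v A"
proof -
  define c where "c = u \<bullet> v"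
  define \<theta> where "\<theta> = arccos c"
  define e where "e = (1 / sin \<theta>) *\<^sub>R (v - cos \<theta> *\<^sub>R u)"
  have uu: "u \<bullet> u = 1" and vv: "v \<bullet> v = 1"
    using u v by (simp_all add: norm_eq_1)
  have "(u - v) \<bullet> (u - v) > 0" "(u + v) \<bullet> (u + v) > 0"
    using \<open>u \<noteq> v\<close> \<open>u \<noteq> - v\<close> by (simp_all add: eq_neg_iff_add_eq_0)
  then have c: "-1 < c" "c < 1"
    by (simp_all add: c_def inner_diff_left inner_diff_right inner_add_left inner_add_right
        uu vv inner_commute)
  have cos: "cos \<theta> = c" and \<theta>: "0 < \<theta>" "\<theta> < pi"
    using c arccos_lt_bounded[of c] by (auto simp: \<theta>_def)
  have s: "sin \<theta> > 0"
    using \<theta> by (simp add: sin_gt_zero)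
  have s2: "sin \<theta> * sin \<theta> = 1 - c * c"
    using sin_cos_squared_add[of \<theta>] cos by (simp add: power2_eq_square)
  have "(v - c *\<^sub>R u) \<bullet> (v - c *\<^sub>R u) = sin \<theta> * sin \<theta>"
    unfolding s2 by (simp add: inner_diff_left inner_diff_right uu vv c_def inner_commute)
  then have "norm (v - c *\<^sub>R u) = sin \<theta>"
    using s by (simp add: norm_eq_sqrt_inner)
  then have e1: "norm e = 1"
    using s by (simp add: e_def cos)
  have eu: "u \<bullet> e = 0"
    by (simp add: e_def inner_diff_right uu cos c_def)
  have ev: "v = cos \<theta> *\<^sub>R u + sin \<theta> *\<^sub>R e"
    using s by (simp add: e_def)
  have arc: "great_circle_arc u v \<theta> ((\<lambda>t. cos t *\<^sub>R u + sin t *\<^sub>R e) ` {0..\<theta>})"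
    unfolding great_circle_arc_def using \<theta> e1 eu ev by auto
  have ge: "\<theta> \<le> L" if "great_circle_arc u v L A" for L A
  proof -
    from that obtain e' where L: "0 \<le> L" "u \<bullet> e' = 0" "v = cos L *\<^sub>R u + sin L *\<^sub>R e'"
      unfolding great_circle_arc_def by blast
    then have "c = cos L"
      by (simp add: c_def inner_add_right uu)
    then show ?thesis
      using L(1) \<theta>(2) arccos_cos[of L] by (cases "L \<le> pi") (auto simp: \<theta>_def)
  qed
  show ?thesis
  proof
    show "shortest_great_circle_arc u v ((\<lambda>t. cos t *\<^sub>R u + sin t *\<^sub>R e) ` {0..\<theta>})"
      unfolding shortest_great_circle_arc_def using arc ge by blast
  next
    fix A assume "shortest_great_circle_arc u v A"
    then obtain L where L: "great_circle_arc u v L A" "L \<le> \<theta>"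
      unfolding shortest_great_circle_arc_def using arc by blast
    then have L': "L = \<theta>"
      using ge by force
    obtain e' where e': "v = cos \<theta> *\<^sub>R u + sin \<theta> *\<^sub>R e'"
      and A: "A = (\<lambda>t. cos t *\<^sub>R u + sin t *\<^sub>R e') ` {0..\<theta>}"
      using L(1) unfolding great_circle_arc_def L' by blast
    have "sin \<theta> *\<^sub>R e' = sin \<theta> *\<^sub>R e"
      using e' ev by (metis add_left_cancel)
    then have "e' = e"
      using s by simp
    then show "A = (\<lambda>t. cos t *\<^sub>R u + sin t *\<^sub>R e) ` {0..\<theta>}"
      using A by simp
  qed
qed

text \<open>A crossing is an unordered pair of edges of the complete graph on \<open>V\<close>, each edge being the
  set of its two endpoints.\<close>

definition crossings :: "(real^3) set \<Rightarrow> (real^3) set set set" where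
  "crossings V = {{{a, b}, {c, d}} | a b c d.
     {a, b, c, d} \<subseteq> V \<and> distinct [a, b, c, d] \<and> spherical_arc a b \<inter> spherical_arc c d \<noteq> {}}"

definition cr :: "(real^3) set \<Rightarrow> nat" where
  "cr V = card (crossings V)"

definition coneighborly :: "(real^3) set \<Rightarrow> bool" where
  "coneighborly V \<longleftrightarrow> (\<forall>a. a \<noteq> 0 \<longrightarrow> (card V - 2) div 2 \<le> card (V \<inter> {x. 0 < a \<bullet> x}))"

end

theory Submission
  imports Defs
begin

text \<open>
  Colour \<open>V\<close> red and blue by the side of a generic plane \<open>N \<bullet> x = 0\<close> that halves it, and let \<open>D a b\<close> be the
  difference of the numbers of vectors on the two sides of the plane spanned by \<open>a\<close> and \<open>b\<close>. Two arcs
  cross iff the linear dependence of their four endpoints has sign pattern \<open>(+,+,-,-)\<close>. A check on the sign patterns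
  of four vectors shows that the number of crossings is a constant plus a positive multiple of the sum of
  \<open>(1 + 3 s a s b) (D a b)\<^sup>2\<close>, where \<open>s = \<plusminus>1\<close> is the colour: monochromatic pairs have weight 4, bichromatic ones
  weight -2. So it suffices that, for each threshold \<open>t\<close>, there are at most as many red-blue pairs with
  \<open>\<bar>D\<bar> \<ge> t\<close> as ordered monochromatic pairs with \<open>\<bar>D\<bar> \<ge> t\<close>. Project to the affine plane \<open>N \<bullet> x = 1\<close> and
  sweep it in all directions in which the red point \<open>r\<close> comes before the blue point \<open>b\<close>. The rank of \<open>r\<close> among
  the red points minus the rank of \<open>b\<close> among the blue ones passes from one extreme to the opposite one, hence
  takes a prescribed middle value, and there a point of the same colour is level with \<open>r\<close> or with \<open>b\<close>. The pair formed by the two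
  is monochromatic, is at least as unbalanced, and determines \<open>(r, b)\<close>. For a coneighborly \<open>V\<close> every \<open>\<bar>D\<bar>\<close>
  is as small as parity allows.
\<close>

section \<open>Signs and determinants\<close>

definition isgn :: "real \<Rightarrow> int" where
  "isgn x = (if 0 < x then 1 else if x < 0 then - 1 else 0)"

lemma isgn_simps [simp]: "isgn 0 = 0" "isgn (- x) = - isgn x"
  by (simp_all add: isgn_def)

lemma isgn_mult: "isgn (x * y) = isgn x * isgn y"
  by (auto simp: isgn_def zero_less_mult_iff mult_less_0_iff)

lemma isgn_divide: "isgn (x / y) = isgn x * isgn y"
  by (auto simp: isgn_def zero_less_divide_iff divide_less_0_iff)

lemma isgn_eq_0_iff [simp]: "isgn x = 0 \<longleftrightarrow> x = 0"
  by (simp add: isgn_def)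

lemma isgn_cases: "x \<noteq> 0 \<Longrightarrow> isgn x = 1 \<or> isgn x = - 1"
  by (simp add: isgn_def)

definition det3 :: "real^3 \<Rightarrow> real^3 \<Rightarrow> real^3 \<Rightarrow> real" where
  "det3 a b c = cross3 a b \<bullet> c"

lemma det3_expand:
  "det3 a b c = a$1*b$2*c$3 - a$1*b$3*c$2 + a$2*b$3*c$1 - a$2*b$1*c$3 + a$3*b$1*c$2 - a$3*b$2*c$1"
  by (simp add: det3_def cross3_def inner_vec_def sum_3 algebra_simps)

lemma det3_swap: "det3 b a c = - det3 a b c"
  by (simp add: det3_expand)

lemma det3_rotate: "det3 b c a = det3 a b c"
  by (simp add: det3_expand)

lemma det3_self [simp]: "det3 a a b = 0" "det3 a b a = 0" "det3 b a a = 0"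
  by (simp_all add: det3_expand)

lemma inner_3: "a \<bullet> b = a$1*b$1 + a$2*b$2 + a$3*b$(3::3)" for a b :: "real^3"
  by (simp add: inner_vec_def sum_3)

text \<open>Cramer's rule. The signs of these coefficients decide whether two arcs cross, and
  pairing the relation with \<open>N\<close> restricts the colours.\<close>

lemma det3_linear_dependence:
  "det3 b c d *\<^sub>R a - det3 a c d *\<^sub>R b + det3 a b d *\<^sub>R c - det3 a b c *\<^sub>R d = 0"
  by (simp add: vec_eq_iff forall_3 det3_expand algebra_simps)

text \<open>If the plane of \<open>a\<close>, \<open>b\<close> and the plane of \<open>c\<close>,
  \<open>d\<close> are distinct, this vector spans their intersection; it is written here in the
  basis \<open>c\<close>, \<open>d\<close>.\<close>

lemma cross3_cross3:
  "cross3 (cross3 a b) (cross3 c d) = det3 a b d *\<^sub>R c - det3 a b c *\<^sub>R d"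
  by (simp add: vec_eq_iff forall_3 det3_expand cross3_def algebra_simps)

text \<open>The matrix with columns \<open>c\<close>, \<open>a\<close>, \<open>b\<close> is
  singular, and the entries of a nonzero kernel vector are the coefficients of a dependence.\<close>

lemma det3_zero_imp_dependent:
  assumes "distinct [a, b, c]" and z: "det3 a b c = 0"
  shows "dependent {a, b, c}"
proof -
  have "det (vector [c, a, b] :: real^3^3) = 0"
    using z by (simp add: det3_def dot_cross_det[symmetric] inner_commute)
  then have "\<not> invertible (transpose (vector [c, a, b] :: real^3^3))"
    by (simp add: invertible_det_nz det_transpose)
  then obtain x where x: "x \<noteq> 0" "transpose (vector [c, a, b] :: real^3^3) *v x = 0"
    by (metis invertible_left_inverse matrix_left_invertible_ker)
  have e: "x$1 *\<^sub>R c + x$2 *\<^sub>R a + x$3 *\<^sub>R b = 0"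
    using x(2) by (simp add: vec_eq_iff forall_3 matrix_vector_mult_def transpose_def sum_3 vector_def algebra_simps)
  have nz: "x$1 \<noteq> 0 \<or> x$2 \<noteq> 0 \<or> x$3 \<noteq> 0"
    using x(1) by (auto simp: vec_eq_iff forall_3)
  define u where "u v = (if v = c then x$1 else if v = a then x$2 else x$3)" for v
  have "(\<Sum>v\<in>{a, b, c}. u v *\<^sub>R v) = 0"
    using assms(1) e by (auto simp: u_def ac_simps)
  moreover have "\<exists>v\<in>{a, b, c}. u v \<noteq> 0"
    using nz assms(1) by (auto simp: u_def)
  ultimately show ?thesis
    by (subst dependent_finite) auto
qed

section \<open>Discrete intermediate values of signed sums\<close>

text \<open>In the order of \<open>\<tau>\<close> the prefix sums start at 0, move by 1 and end at
  \<open>d\<close> or above, so some element raises them from \<open>d - 1\<close> to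
  \<open>d\<close>. The induction removes the last element.\<close>

lemma prefix_sum_attains:
  fixes \<tau> :: "'a \<Rightarrow> real" and w :: "'a \<Rightarrow> int"
  assumes "finite T" and "inj_on \<tau> T" and "\<And>v. v \<in> T \<Longrightarrow> w v = 1 \<or> w v = - 1"
    and "1 \<le> d" and "d \<le> sum w T"
  shows "\<exists>v\<in>T. w v = 1 \<and> sum w {u\<in>T. \<tau> u < \<tau> v} = d - 1"
  using assms
proof (induction "card T" arbitrary: T)
  case 0
  then show ?case by auto
next
  case (Suc k)
  then have ne: "T \<noteq> {}" by auto
  then have "Max (\<tau> ` T) \<in> \<tau> ` T" using Suc.prems(1) by (intro Max_in) auto
  then obtain m where "m \<in> T" "\<tau> m = Max (\<tau> ` T)" by auto
  then have m: "m \<in> T" "\<forall>u\<in>T. \<tau> u \<le> \<tau> m" using Suc.prems(1) by auto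
  define T' where "T' = T - {m}"
  have lt: "\<tau> u < \<tau> m" if "u \<in> T'" for u
    using that m inj_onD[OF Suc.prems(2), of u m] by (fastforce simp: T'_def order_le_less)
  have s: "sum w T = w m + sum w T'"
    using m(1) Suc.prems(1) by (simp add: T'_def sum.remove)
  show ?case
  proof (cases "d \<le> sum w T'")
    case True
    have "\<exists>v\<in>T'. w v = 1 \<and> sum w {u\<in>T'. \<tau> u < \<tau> v} = d - 1"
    proof (rule Suc.hyps(1))
      show "k = card T'" using Suc.hyps(2) m(1) Suc.prems(1) by (simp add: T'_def)
      show "inj_on \<tau> T'" using Suc.prems(2) by (auto simp: T'_def inj_on_diff)
      show "finite T'" using Suc.prems(1) by (simp add: T'_def)
      show "w v = 1 \<or> w v = - 1" if "v \<in> T'" for v using that Suc.prems(3) by (simp add: T'_def)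
    qed (fact Suc.prems(4) True)+
    then obtain v where v: "v \<in> T'" "w v = 1" "sum w {u\<in>T'. \<tau> u < \<tau> v} = d - 1"
      by blast
    have "{u\<in>T. \<tau> u < \<tau> v} = {u\<in>T'. \<tau> u < \<tau> v}"
      using lt[OF v(1)] by (auto simp: T'_def)
    then show ?thesis using v by (auto simp: T'_def)
  next
    case False
    then have "w m = 1" "sum w T' = d - 1"
      using s Suc.prems(3)[OF m(1)] Suc.prems(5) by auto
    moreover have "{u\<in>T. \<tau> u < \<tau> m} = T'"
      using lt by (auto simp: T'_def)
    ultimately show ?thesis using m(1) by auto
  qed
qed

text \<open>As a threshold moves upwards past all values of \<open>\<tau>\<close>, the signed sum
  goes from \<open>sum \<sigma> T\<close> to its negative in jumps of 2, and at a jump it takes the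
  middle value. Between jumps it has the parity of \<open>t\<close>, so it must jump across
  \<open>t - 1\<close>, which lies strictly between the two extremes.\<close>

lemma sign_sum_attains:
  fixes \<tau> :: "'a \<Rightarrow> real" and \<sigma> :: "'a \<Rightarrow> int"
  assumes fin: "finite T" and inj: "inj_on \<tau> T" and pm: "\<And>v. v \<in> T \<Longrightarrow> \<sigma> v = 1 \<or> \<sigma> v = - 1"
    and "1 \<le> t" and "t \<le> \<bar>sum \<sigma> T\<bar>" and "even (sum \<sigma> T - t)"
  shows "\<exists>v\<in>T. (\<Sum>u\<in>T. \<sigma> u * isgn (\<tau> u - \<tau> v)) = t - 1"
proof -
  define D where "D = sum \<sigma> T"
  have key: "(\<Sum>u\<in>T. \<sigma> u * isgn (\<tau> u - \<tau> v)) = D - \<sigma> v - 2 * sum \<sigma> {u\<in>T. \<tau> u < \<tau> v}"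
    if v: "v \<in> T" for v
  proof -
    have "(\<Sum>u\<in>T. \<sigma> u * isgn (\<tau> u - \<tau> v))
        = (\<Sum>u\<in>T. \<sigma> u - (if u = v then \<sigma> u else 0) - 2 * (if \<tau> u < \<tau> v then \<sigma> u else 0))"
    proof (rule sum.cong)
      fix u assume u: "u \<in> T"
      consider "u = v" | "\<tau> u < \<tau> v" "u \<noteq> v" | "\<tau> v < \<tau> u" "u \<noteq> v"
        using inj_onD[OF inj _ u v] by fastforce
      then show "\<sigma> u * isgn (\<tau> u - \<tau> v)
          = \<sigma> u - (if u = v then \<sigma> u else 0) - 2 * (if \<tau> u < \<tau> v then \<sigma> u else 0)"
        by cases (simp_all add: isgn_def)
    qed simp
    also have "\<dots> = D - \<sigma> v - 2 * (\<Sum>u\<in>T. if \<tau> u < \<tau> v then \<sigma> u else 0)"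
      unfolding sum_subtractf D_def sum_distrib_left[symmetric] using fin v by simp
    also have "(\<Sum>u\<in>T. if \<tau> u < \<tau> v then \<sigma> u else 0) = sum \<sigma> {u\<in>T. \<tau> u < \<tau> v}"
      by (rule sum.inter_filter[OF fin, symmetric])
    finally show ?thesis .
  qed
  show ?thesis
  proof (cases "D \<ge> t")
    case True
    \<comment> \<open>Solves \<open>D - 1 - 2 * (d - 1) = t - 1\<close>, which is \<open>key\<close>
      for an element with \<open>\<sigma> v = 1\<close>.\<close>
    define d where "d = (D - t) div 2 + 1"
    have d: "2 * d = D - t + 2" using assms(6) unfolding d_def D_def by presburger
    have "\<exists>v\<in>T. \<sigma> v = 1 \<and> sum \<sigma> {u\<in>T. \<tau> u < \<tau> v} = d - 1"
    proof (rule prefix_sum_attains[OF fin inj])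
      show "1 \<le> d" "d \<le> sum \<sigma> T" using d True assms(4) unfolding D_def by linarith+
    qed (rule pm)
    then obtain v where v: "v \<in> T" "\<sigma> v = 1" "sum \<sigma> {u\<in>T. \<tau> u < \<tau> v} = d - 1"
      by blast
    then have "(\<Sum>u\<in>T. \<sigma> u * isgn (\<tau> u - \<tau> v)) = t - 1" using key[OF v(1)] d by linarith
    with v(1) show ?thesis by blast
  next
    case False
    then have D: "D \<le> - t" using assms(5) by (simp add: D_def)
    \<comment> \<open>Here the jump occurs at an element with \<open>\<sigma> v = - 1\<close>, found
      by applying \<open>prefix_sum_attains\<close> to the negated signs; \<open>d\<close> solves
      \<open>D + 1 + 2 * (d - 1) = t - 1\<close>.\<close>
    define d where "d = (t - D) div 2"
    have "even (t - D)" using assms(6) by (simp add: D_def)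
    then have d: "2 * d = t - D" unfolding d_def by presburger
    have sm: "sum (\<lambda>u. - \<sigma> u) T = - D" by (simp add: D_def sum_negf)
    have "\<exists>v\<in>T. - \<sigma> v = 1 \<and> sum (\<lambda>u. - \<sigma> u) {u\<in>T. \<tau> u < \<tau> v} = d - 1"
    proof (rule prefix_sum_attains[OF fin inj])
      show "- \<sigma> v = 1 \<or> - \<sigma> v = - 1" if "v \<in> T" for v using pm[OF that] by auto
      show "1 \<le> d" "d \<le> (\<Sum>u\<in>T. - \<sigma> u)" using d D assms(4) sm by linarith+
    qed
    then obtain v where v: "v \<in> T" "- \<sigma> v = 1" "- sum \<sigma> {u\<in>T. \<tau> u < \<tau> v} = d - 1"
      unfolding sum_negf by blast
    then have "(\<Sum>u\<in>T. \<sigma> u * isgn (\<tau> u - \<tau> v)) = t - 1" using key[OF v(1)] d by linarith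
    with v(1) show ?thesis by blast
  qed
qed

section \<open>Bichromatic and monochromatic pairs\<close>

definition orient :: "real^3 \<Rightarrow> real^3 \<Rightarrow> real^3 \<Rightarrow> int" where
  "orient a b c = isgn (det3 a b c)"

text \<open>This is the \<open>D a b\<close> of the introduction; \<open>a\<close> and
  \<open>b\<close> themselves contribute 0.\<close>

definition imbalance :: "(real^3) set \<Rightarrow> real^3 \<Rightarrow> real^3 \<Rightarrow> int" where
  "imbalance V a b = (\<Sum>c\<in>V. orient a b c)"

text \<open>By the triple product expansion \<open>\<phi>\<close> has zero cross product with
  \<open>cross3 x y\<close>, so the two are collinear.\<close>

lemma perp_imp_parallel_cross3:
  fixes x y \<phi> :: "real^3"
  assumes "\<phi> \<bullet> x = 0" and "\<phi> \<bullet> y = 0" and "cross3 x y \<noteq> 0"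
  obtains \<kappa> where "\<phi> = \<kappa> *\<^sub>R cross3 x y"
proof -
  have "cross3 (cross3 x y) \<phi> = (\<phi> \<bullet> x) *\<^sub>R y - (\<phi> \<bullet> y) *\<^sub>R x"
    by (simp add: vec_eq_iff forall_3 cross3_def inner_3 algebra_simps)
  then have "cross3 (cross3 x y) \<phi> = 0"
    using assms by simp
  then show ?thesis
    using assms(3) that unfolding cross_eq_0 collinear_lemma by (metis scaleR_zero_left)
qed

locale vector_config =
  fixes V :: "(real^3) set"
  assumes finite_V: "finite V"
    and cross3_nz: "\<lbrakk>a \<in> V; b \<in> V; a \<noteq> b\<rbrakk> \<Longrightarrow> cross3 a b \<noteq> 0"
    and det3_nz: "\<lbrakk>a \<in> V; b \<in> V; c \<in> V; distinct [a, b, c]\<rbrakk> \<Longrightarrow> det3 a b c \<noteq> 0"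
begin

lemma orient_cases:
  "\<lbrakk>a \<in> V; b \<in> V; c \<in> V; distinct [a, b, c]\<rbrakk> \<Longrightarrow> orient a b c = 1 \<or> orient a b c = - 1"
  unfolding orient_def by (rule isgn_cases[OF det3_nz])

end

text \<open>In the chart \<open>N \<bullet> x = 1\<close>, the assumption \<open>N_generic\<close>
  says that the line through \<open>a\<close>, \<open>b\<close> is not parallel to the line through
  \<open>c\<close>, \<open>d\<close>. This keeps the events of the sweep apart.\<close>

locale coloured_config = vector_config +
  fixes N :: "real^3"
  assumes N_nz: "v \<in> V \<Longrightarrow> N \<bullet> v \<noteq> 0"
    and N_generic: "\<lbrakk>a \<in> V; b \<in> V; c \<in> V; d \<in> V; distinct [a, b, c, d]\<rbrakk>
      \<Longrightarrow> N \<bullet> cross3 (cross3 a b) (cross3 c d) \<noteq> 0"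
begin

abbreviation colour :: "real^3 \<Rightarrow> int" where
  "colour v \<equiv> isgn (N \<bullet> v)"

text \<open>In the affine chart \<open>N \<bullet> x = 1\<close>, let a function \<open>f\<close> order the points. Every point is compared with the
  one of \<open>r\<close> (red) and \<open>b\<close> (blue) that has its own colour, so \<open>rank_diff f r b\<close> is, up to an additive
  constant, twice the rank of \<open>r\<close> among the red points minus twice the rank of \<open>b\<close> among the blue ones.\<close>

definition match :: "real^3 \<Rightarrow> real^3 \<Rightarrow> real^3 \<Rightarrow> real^3" where
  "match r b p = (if 0 < N \<bullet> p then r else b)"

text \<open>In the same chart, an affine function that vanishes on the line through \<open>x\<close> and \<open>y\<close>.\<close>

definition elevation :: "real^3 \<Rightarrow> real^3 \<Rightarrow> real^3 \<Rightarrow> real" where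
  "elevation x y p = (cross3 x y \<bullet> p) / (N \<bullet> p)"

definition rank_diff :: "(real^3 \<Rightarrow> real) \<Rightarrow> real^3 \<Rightarrow> real^3 \<Rightarrow> int" where
  "rank_diff f r b = (\<Sum>p\<in>V. colour p * isgn (f (match r b p) - f p))"

text \<open>The ordered pair \<open>(x, y)\<close> determines the scaling factor \<open>\<kappa>\<close> up to its absolute value, hence the order of
  the points, the endpoint \<open>x \<in> {r, b}\<close>, and then the other endpoint through its rank.\<close>

definition witness :: "int \<Rightarrow> real^3 \<Rightarrow> real^3 \<Rightarrow> real^3 \<Rightarrow> real^3 \<Rightarrow> bool" where
  "witness t r b x y \<longleftrightarrow> match r b x = x \<and> match r b y = x \<and>
     (\<exists>\<kappa>::real. \<kappa> * imbalance V x y < 0 \<and> rank_diff (\<lambda>p. \<kappa> * elevation x y p) r b = t - 1)"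

text \<open>Rotate the direction \<open>g + s c\<close> of the ordering \<open>F s\<close> through the half turn in which \<open>r\<close> precedes \<open>b\<close>.
  Then \<open>rank_diff\<close> moves from \<open>imbalance V r b\<close> to its negative, changing only when some \<open>y\<close> becomes level with
  the endpoint of its colour; at the moment where it passes \<open>t - 1\<close>, the line through \<open>y\<close> and this endpoint is as
  unbalanced as required.\<close>

lemma exists_witness:
  assumes r: "r \<in> V" "0 < N \<bullet> r" and b: "b \<in> V" "N \<bullet> b < 0"
    and t: "1 \<le> t" "t \<le> \<bar>imbalance V r b\<bar>" "even (imbalance V r b - t)"
  shows "\<exists>x\<in>V. \<exists>y\<in>V. x \<noteq> y \<and> t \<le> \<bar>imbalance V x y\<bar> \<and> witness t r b x y"
proof -
  \<comment> \<open>In the chart \<open>Y\<close> vanishes on the line through \<open>r\<close> and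
    \<open>b\<close>, and \<open>g\<close> is a positive multiple of the difference of the points of
    \<open>b\<close> and \<open>r\<close>, so \<open>X\<close> increases from \<open>r\<close> to
    \<open>b\<close>. Up to a positive factor and a constant, the functions \<open>X + s * Y\<close>
    are all the affine functions that increase from \<open>r\<close> to \<open>b\<close>.\<close>
  define c where "c = cross3 r b"
  define g where "g = cross3 N c"
  define X where "X p = (g \<bullet> p) / (N \<bullet> p)" for p
  define Y where "Y p = (c \<bullet> p) / (N \<bullet> p)" for p
  define m where "m = match r b"
  define T where "T = V - {r, b}"
  \<comment> \<open>The parameter \<open>s\<close> at which \<open>p\<close> is level with its
    partner \<open>m p\<close>, because \<open>Y\<close> vanishes at the partner.\<close>
  define \<tau> where "\<tau> p = (X (m p) - X p) / Y p" for p
  have rb: "r \<noteq> b" using r(2) b(2) by auto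
  have c0: "c \<noteq> 0" using cross3_nz[OF r(1) b(1) rb] by (simp add: c_def)
  have m_cases: "m p = r \<or> m p = b" for p by (simp add: m_def match_def)
  have mr: "m r = r" and mb: "m b = b" using r b by (simp_all add: m_def match_def)
  have mV: "m p \<in> V" for p using m_cases[of p] r b by auto
  have mm: "m (m p) = m p" for p using m_cases[of p] mr mb by auto
  have Yrb: "Y r = 0" "Y b = 0" by (simp_all add: Y_def c_def dot_cross_self)
  then have Ym: "Y (m p) = 0" for p using m_cases[of p] by auto
  have XY: "X r < X b"
  proof -
    have g_eq: "g = (N \<bullet> b) *\<^sub>R r - (N \<bullet> r) *\<^sub>R b"
      by (simp add: g_def c_def vec_eq_iff forall_3 cross3_def inner_3 algebra_simps)
    then have "cross3 g b = (N \<bullet> b) *\<^sub>R c"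
      by (simp add: c_def cross_mult_left Cross3.left_diff_distrib)
    then have "g \<noteq> 0" using c0 b by auto
    moreover have "g \<bullet> g = (g \<bullet> r) * (N \<bullet> b) - (g \<bullet> b) * (N \<bullet> r)"
      using arg_cong[OF g_eq, of "(\<bullet>) g"] by (simp add: inner_diff_right mult.commute)
    ultimately have "(g \<bullet> b) * (N \<bullet> r) < (g \<bullet> r) * (N \<bullet> b)"
      using inner_gt_zero_iff[of g] by simp
    moreover have "X b - X r = ((g \<bullet> b) * (N \<bullet> r) - (g \<bullet> r) * (N \<bullet> b)) / ((N \<bullet> b) * (N \<bullet> r))"
      using r b by (simp add: X_def field_simps)
    moreover have "(N \<bullet> b) * (N \<bullet> r) < 0" using r b by (simp add: mult_neg_pos)
    ultimately have "X b - X r > 0" by (simp add: divide_neg_neg)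
    then show ?thesis by simp
  qed
  have Yp: "Y p \<noteq> 0" if "p \<in> T" for p
    using det3_nz[of r b p] that r b rb N_nz[of p] by (auto simp: T_def c_def det3_def Y_def)
  define F where "F s p = X p + s * Y p" for s p
  have F_diff: "F s (m p) - F s p = Y p * (\<tau> p - s)" if "p \<in> T" for s p
    using Yp[OF that] by (simp add: F_def Ym \<tau>_def field_simps)
  \<comment> \<open>The linear form whose kernel meets the chart in the level line of
    \<open>F s\<close> through \<open>z\<close>.\<close>
  define \<phi> where "\<phi> s z = g + s *\<^sub>R c - F s z *\<^sub>R N" for s z
  have \<phi>: "\<phi> s z \<bullet> p = (F s p - F s z) * (N \<bullet> p)" if "p \<in> V" for s z p
    using N_nz[OF that] by (simp add: \<phi>_def F_def X_def Y_def inner_diff_left inner_add_left field_simps)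
  have Frb: "F s r < F s b" for s using XY by (simp add: F_def Yrb)
  have \<phi>_nz: "\<phi> s z \<noteq> 0" for s z
  proof
    assume "\<phi> s z = 0"
    then have "F s r = F s z" "F s b = F s z" using \<phi>[OF r(1), of s z] \<phi>[OF b(1), of s z] r b by auto
    then show False using Frb[of s] by simp
  qed
  have inj: "inj_on \<tau> T"
  proof (rule inj_onI, rule ccontr)
    fix p q assume pq: "p \<in> T" "q \<in> T" "\<tau> p = \<tau> q" "p \<noteq> q"
    define s where "s = \<tau> p"
    have F: "F s (m p) = F s p" "F s (m q) = F s q"
      using F_diff[OF pq(1), of s] F_diff[OF pq(2), of s] pq(3) by (auto simp: s_def)
    have V: "p \<in> V" "q \<in> V" "p \<noteq> m p" "q \<noteq> m q" "p \<noteq> m q" "q \<noteq> m p"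
      using pq(1,2) m_cases[of p] m_cases[of q] by (auto simp: T_def)
    have zero: "\<phi> s (m p) \<bullet> m p = 0" "\<phi> s (m p) \<bullet> p = 0" "\<phi> s (m q) \<bullet> m q = 0" "\<phi> s (m q) \<bullet> q = 0"
      by (simp_all add: \<phi> mV V F)
    have nz: "cross3 (m p) p \<noteq> 0" "cross3 (m q) q \<noteq> 0"
      using cross3_nz[OF mV] V by metis+
    obtain \<kappa>1 where k1: "\<phi> s (m p) = \<kappa>1 *\<^sub>R cross3 (m p) p"
      using perp_imp_parallel_cross3[OF zero(1,2) nz(1)] .
    show False
    proof (cases "m p = m q")
      case True
      \<comment> \<open>With a common partner the nonzero form would vanish at the three independent
        vectors \<open>m p\<close>, \<open>p\<close> and \<open>q\<close>.\<close>
      have "\<kappa>1 * det3 (m p) p q = \<phi> s (m p) \<bullet> q" by (simp add: k1 det3_def)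
      also have "\<dots> = 0" using zero(4) by (simp add: True)
      finally have "\<kappa>1 = 0" using det3_nz[OF mV V(1,2), of p] V pq(4) True by auto
      then show False using k1 \<phi>_nz by simp
    next
      case False
      obtain \<kappa>2 where k2: "\<phi> s (m q) = \<kappa>2 *\<^sub>R cross3 (m q) q"
        using perp_imp_parallel_cross3[OF zero(3,4) nz(2)] .
      \<comment> \<open>With different partners the lines from \<open>p\<close> and \<open>q\<close>
        to them are parallel level lines. The two forms both vanish at \<open>w\<close> and differ
        by a nonzero multiple of \<open>N\<close>, so \<open>N \<bullet> w = 0\<close>, against
        \<open>N_generic\<close>.\<close>
      define w where "w = cross3 (cross3 (m p) p) (cross3 (m q) q)"
      have "\<phi> s (m p) \<bullet> w = 0" "\<phi> s (m q) \<bullet> w = 0"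
        by (simp_all add: k1 k2 w_def dot_cross_self)
      then have "(F s (m p) - F s (m q)) * (N \<bullet> w) = 0"
        by (simp add: \<phi>_def inner_diff_left inner_add_left algebra_simps)
      moreover have "F s (m p) \<noteq> F s (m q)"
        using False m_cases[of p] m_cases[of q] Frb[of s] by (metis less_irrefl)
      moreover have "N \<bullet> w \<noteq> 0"
      proof -
        have "distinct [m p, p, m q, q]" using V(3-6) pq(4) False by simp
        then show ?thesis unfolding w_def using N_generic[OF mV V(1) mV V(2)] by blast
      qed
      ultimately show False by simp
    qed
  qed
  have sumT: "sum (orient r b) T = imbalance V r b"
    unfolding imbalance_def T_def
  proof (rule sum.mono_neutral_left)
    show "\<forall>i\<in>V - (V - {r, b}). orient r b i = 0" by (auto simp: orient_def)
  qed (use finite_V in auto)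
  \<comment> \<open>The sum is the value of \<open>rank_diff\<close> at the parameter
    \<open>\<tau> v\<close>, as \<open>rd\<close> verifies below; this is where it passes
    \<open>t - 1\<close>.\<close>
  have "\<exists>v\<in>T. (\<Sum>u\<in>T. orient r b u * isgn (\<tau> u - \<tau> v)) = t - 1"
  proof (rule sign_sum_attains[OF _ inj])
    show "orient r b v = 1 \<or> orient r b v = - 1" if "v \<in> T" for v
      using that rb by (intro orient_cases r(1) b(1)) (auto simp: T_def)
    show "finite T" by (simp add: T_def finite_V)
  qed (use t in \<open>simp_all add: sumT\<close>)
  then obtain y where y: "y \<in> T" "(\<Sum>u\<in>T. orient r b u * isgn (\<tau> u - \<tau> y)) = t - 1" by blast
  define x where "x = m y"
  define f where "f = F (\<tau> y)"
  have xy: "x \<in> V" "y \<in> V" "x \<noteq> y" "m x = x" "m y = x"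
    using y(1) mV m_cases[of y] mm by (auto simp: T_def x_def)
  have fxy: "f x = f y" using F_diff[OF y(1), of "\<tau> y"] by (simp add: f_def x_def)
  have rd: "rank_diff f r b = t - 1"
  proof -
    have "rank_diff f r b = (\<Sum>u\<in>T. colour u * isgn (f (m u) - f u))"
      unfolding rank_diff_def T_def m_def[symmetric]
      by (rule sum.mono_neutral_right) (auto simp: finite_V mr mb)
    also have "\<dots> = (\<Sum>u\<in>T. orient r b u * isgn (\<tau> u - \<tau> y))"
    proof (rule sum.cong)
      fix u assume u: "u \<in> T"
      \<comment> \<open>The sign of \<open>Y u\<close> is \<open>orient r b u\<close> times the
        colour of \<open>u\<close>, so the two colour factors cancel.\<close>
      have "colour u * colour u = 1" using isgn_cases[OF N_nz, of u] u by (auto simp: T_def)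
      then show "colour u * isgn (f (m u) - f u) = orient r b u * isgn (\<tau> u - \<tau> y)"
        unfolding f_def F_diff[OF u] by (simp add: isgn_mult isgn_divide Y_def orient_def det3_def c_def)
    qed simp
    finally show ?thesis using y(2) by simp
  qed
  have "\<phi> (\<tau> y) x \<bullet> x = 0" "\<phi> (\<tau> y) x \<bullet> y = 0" "cross3 x y \<noteq> 0"
    using fxy xy(1-3) by (simp_all add: \<phi> f_def cross3_nz)
  then obtain \<kappa> where k: "\<phi> (\<tau> y) x = \<kappa> *\<^sub>R cross3 x y"
    using perp_imp_parallel_cross3 by blast
  have fs: "f p = f x + \<kappa> * elevation x y p" if "p \<in> V" for p
    using \<phi>[OF that, of "\<tau> y" x] N_nz[OF that] unfolding k by (simp add: elevation_def f_def field_simps)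
  have rd': "rank_diff (\<lambda>p. \<kappa> * elevation x y p) r b = t - 1"
  proof -
    have "rank_diff (\<lambda>p. \<kappa> * elevation x y p) r b = rank_diff f r b"
      unfolding rank_diff_def m_def[symmetric]
    proof (intro sum.cong refl arg_cong2[where f="(*)"] arg_cong[where f=isgn])
      show "\<kappa> * elevation x y (m p) - \<kappa> * elevation x y p = f (m p) - f p" if "p \<in> V" for p
        using fs[OF that] fs[OF mV] by simp
    qed
    then show ?thesis using rd by simp
  qed
  \<comment> \<open>When every point is compared with \<open>x\<close>, the colour cancels the sign
    of the denominator in \<open>elevation\<close> and only the orientation with respect to
    \<open>x\<close>, \<open>y\<close> remains.\<close>
  have D: "(\<Sum>p\<in>V. colour p * isgn (f x - f p)) = - (isgn \<kappa> * imbalance V x y)"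
    unfolding imbalance_def sum_distrib_left sum_negf[symmetric]
  proof (rule sum.cong)
    fix p assume p: "p \<in> V"
    have "colour p * colour p = 1" using isgn_cases[OF N_nz[OF p]] by auto
    then show "colour p * isgn (f x - f p) = - (isgn \<kappa> * orient x y p)"
      using fs[OF p] by (simp add: isgn_mult isgn_divide elevation_def orient_def det3_def)
  qed simp
  \<comment> \<open>The endpoint other than \<open>x\<close>. Since \<open>f r < f b\<close>,
    comparing every point with \<open>x\<close> instead of its own partner decreases no term, and it
    raises the term of \<open>z\<close> from 0 to 1. This unit turns \<open>t - 1\<close> into
    \<open>t\<close>.\<close>
  define z where "z = (if x = r then b else r)"
  have "rank_diff f r b + 1 = (\<Sum>p\<in>V. colour p * isgn (f (m p) - f p) + (if p = z then 1 else 0))"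
    using finite_V r b by (simp add: rank_diff_def m_def sum.distrib z_def)
  also have "\<dots> \<le> (\<Sum>p\<in>V. colour p * isgn (f x - f p))"
  proof (rule sum_mono)
    fix p assume p: "p \<in> V"
    have frb: "f r < f b" using Frb by (simp add: f_def)
    show "colour p * isgn (f (m p) - f p) + (if p = z then 1 else 0) \<le> colour p * isgn (f x - f p)"
    proof (cases "m p = x")
      case True
      then have "p \<noteq> z" using mr mb rb m_cases[of y] by (auto simp: z_def x_def split: if_splits)
      then show ?thesis using True by simp
    next
      case False
      then consider "x = r" "m p = b" | "x = b" "m p = r" using m_cases[of p] m_cases[of y] by (auto simp: x_def)
      then show ?thesis
      proof cases
        case 1
        then have "N \<bullet> p < 0" using rb N_nz[OF p] by (auto simp: m_def match_def split: if_splits)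
        then have "colour p = - 1" by (simp add: isgn_def)
        then show ?thesis using 1 frb rb by (auto simp: z_def isgn_def)
      next
        case 2
        then have "N \<bullet> p > 0" using rb N_nz[OF p] by (auto simp: m_def match_def split: if_splits)
        then have "colour p = 1" by (simp add: isgn_def)
        then show ?thesis using 2 frb rb by (auto simp: z_def isgn_def)
      qed
    qed
  qed
  finally have ge: "t \<le> - (isgn \<kappa> * imbalance V x y)" using rd D by simp
  then have "t \<le> \<bar>imbalance V x y\<bar>" "\<kappa> * imbalance V x y < 0"
    using t(1) by (auto simp: isgn_def mult_less_0_iff split: if_splits)
  then have "witness t r b x y"
    using xy rd' unfolding witness_def m_def by blast
  then show ?thesis
    using xy \<open>t \<le> \<bar>imbalance V x y\<bar>\<close> by blast
qed

end

section \<open>Injectivity of the choice of witnesses\<close>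

context coloured_config
begin

text \<open>Blue terms carry the sign -1, so they can only fall as the level of the blue endpoint
  rises, and the term of \<open>b\<close> itself falls strictly. Hence for a fixed red endpoint
  \<open>rank_diff\<close> determines the level of the blue one.\<close>

lemma rank_diff_less_blue:
  assumes "b \<in> V" "N \<bullet> b < 0" "f b < f b'"
  shows "rank_diff f r b' < rank_diff f r b"
  unfolding rank_diff_def
proof (rule sum_strict_mono_ex1[OF finite_V])
  show "\<forall>p\<in>V. colour p * isgn (f (match r b' p) - f p) \<le> colour p * isgn (f (match r b p) - f p)"
    using assms(3) by (auto simp: match_def isgn_def)
  show "\<exists>p\<in>V. colour p * isgn (f (match r b' p) - f p) < colour p * isgn (f (match r b p) - f p)"
    using assms by (intro bexI[of _ b]) (auto simp: match_def isgn_def)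
qed

lemma rank_diff_less_red:
  assumes "r \<in> V" "0 < N \<bullet> r" "f r < f r'"
  shows "rank_diff f r b < rank_diff f r' b"
  unfolding rank_diff_def
proof (rule sum_strict_mono_ex1[OF finite_V])
  show "\<forall>p\<in>V. colour p * isgn (f (match r b p) - f p) \<le> colour p * isgn (f (match r' b p) - f p)"
    using assms(3) by (auto simp: match_def isgn_def)
  show "\<exists>p\<in>V. colour p * isgn (f (match r b p) - f p) < colour p * isgn (f (match r' b p) - f p)"
    using assms by (intro bexI[of _ r]) (auto simp: match_def isgn_def)
qed

text \<open>Distinct points of equal elevation would span a line parallel to the line through
  \<open>x\<close> and \<open>y\<close>, which \<open>N_generic\<close> excludes.\<close>

lemma elevation_inj:
  assumes V: "x \<in> V" "y \<in> V" "p \<in> V" "q \<in> V" and d: "distinct [x, y, p]" "distinct [x, y, q]"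
    and eq: "elevation x y p = elevation x y q"
  shows "p = q"
proof (rule ccontr)
  assume pq: "p \<noteq> q"
  define \<phi> where "\<phi> = cross3 x y - elevation x y p *\<^sub>R N"
  have "\<phi> \<bullet> p = 0" "\<phi> \<bullet> q = 0"
    using N_nz V eq by (simp_all add: \<phi>_def inner_diff_left elevation_def field_simps)
  then obtain \<kappa> where k: "\<phi> = \<kappa> *\<^sub>R cross3 p q"
    using perp_imp_parallel_cross3 cross3_nz[OF V(3,4) pq] by blast
  define w where "w = cross3 (cross3 x y) (cross3 p q)"
  have "\<phi> \<bullet> w = 0" "cross3 x y \<bullet> w = 0" by (simp_all add: k w_def dot_cross_self)
  then have "elevation x y p * (N \<bullet> w) = 0" by (simp add: \<phi>_def inner_diff_left)
  moreover have "elevation x y p \<noteq> 0"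
    using det3_nz[OF V(1,2,3) d(1)] N_nz[OF V(3)] by (simp add: elevation_def det3_def)
  moreover have "N \<bullet> w \<noteq> 0"
    unfolding w_def using N_generic[OF V] d pq by auto
  ultimately show False by simp
qed

lemma witness_inj:
  assumes w: "witness t r b x y" "witness t r' b' x y"
    and V: "r \<in> V" "0 < N \<bullet> r" "b \<in> V" "N \<bullet> b < 0" "r' \<in> V" "0 < N \<bullet> r'" "b' \<in> V" "N \<bullet> b' < 0"
    and xy: "x \<in> V" "y \<in> V" "x \<noteq> y"
  shows "r = r' \<and> b = b'"
proof -
  obtain \<kappa> :: real where m: "match r b x = x" "match r b y = x"
    and k: "\<kappa> * imbalance V x y < 0" "rank_diff (\<lambda>p. \<kappa> * elevation x y p) r b = t - 1"
    using w(1) unfolding witness_def by blast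
  obtain \<kappa>' :: real where m': "match r' b' x = x" "match r' b' y = x"
    and k': "\<kappa>' * imbalance V x y < 0" "rank_diff (\<lambda>p. \<kappa>' * elevation x y p) r' b' = t - 1"
    using w(2) unfolding witness_def by blast
  \<comment> \<open>Both factors have the sign opposite to the imbalance of \<open>x\<close> and
    \<open>y\<close>, so they order the points in the same way.\<close>
  have sg: "isgn \<kappa>' = isgn \<kappa>" using k(1) k'(1) by (auto simp: isgn_def mult_less_0_iff)
  have "rank_diff (\<lambda>p. \<kappa>' * elevation x y p) r' b' = rank_diff (\<lambda>p. \<kappa> * elevation x y p) r' b'"
    unfolding rank_diff_def right_diff_distrib[symmetric] isgn_mult sg ..
  with k(2) k'(2) have eq: "rank_diff (\<lambda>p. \<kappa> * elevation x y p) r b = rank_diff (\<lambda>p. \<kappa> * elevation x y p) r' b'"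
    by simp
  have k0: "\<kappa> \<noteq> 0" using k(1) by auto
  show ?thesis
  proof (cases "0 < N \<bullet> x")
    case True
    then have rr: "x = r" "x = r'" using m(1) m'(1) by (simp_all add: match_def)
    \<comment> \<open>As \<open>y\<close> has the colour of \<open>x\<close>, it differs from
      \<open>b\<close> and \<open>b'\<close>, which \<open>elevation_inj\<close> requires.\<close>
    have y: "0 < N \<bullet> y" using m(2) rr(1) V(2,4) by (auto simp: match_def split: if_splits)
    have "\<kappa> * elevation x y b = \<kappa> * elevation x y b'"
      using rank_diff_less_blue[of b "\<lambda>p. \<kappa> * elevation x y p" b' r] rank_diff_less_blue[of b' "\<lambda>p. \<kappa> * elevation x y p" b r]
        V eq rr by (metis linorder_neqE_linordered_idom order_less_irrefl)
    then have "elevation x y b = elevation x y b'" using k0 by simp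
    then have "b = b'"
      by (rule elevation_inj[OF xy(1,2) V(3,7), rotated 2]) (use True y V xy(3) in auto)
    then show ?thesis using rr by simp
  next
    case False
    then have bb: "x = b" "x = b'" using m(1) m'(1) by (simp_all add: match_def)
    have y: "N \<bullet> y < 0" using m(2) bb(1) V(2,4) N_nz[OF xy(2)] by (auto simp: match_def split: if_splits)
    have "\<kappa> * elevation x y r = \<kappa> * elevation x y r'"
      using rank_diff_less_red[of r "\<lambda>p. \<kappa> * elevation x y p" r' b] rank_diff_less_red[of r' "\<lambda>p. \<kappa> * elevation x y p" r b]
        V eq bb by (metis linorder_neqE_linordered_idom order_less_irrefl)
    then have "elevation x y r = elevation x y r'" using k0 by simp
    then have "r = r'"
      by (rule elevation_inj[OF xy(1,2) V(1,5), rotated 2]) (use False y V xy(3) in auto)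
    then show ?thesis using bb by simp
  qed
qed

definition bichromatic :: "int \<Rightarrow> ((real^3) \<times> (real^3)) set" where
  "bichromatic t = {(r, b). r \<in> V \<and> b \<in> V \<and> 0 < N \<bullet> r \<and> N \<bullet> b < 0 \<and> t \<le> \<bar>imbalance V r b\<bar>}"

text \<open>Both orders of a monochromatic pair are counted, but a pair in
  \<open>bichromatic\<close> is listed only as (red, blue). This factor 2 corresponds to the weights
  4 and -2.\<close>

definition monochromatic :: "int \<Rightarrow> ((real^3) \<times> (real^3)) set" where
  "monochromatic t = {(x, y). x \<in> V \<and> y \<in> V \<and> x \<noteq> y \<and> colour x = colour y \<and> t \<le> \<bar>imbalance V x y\<bar>}"

lemma finite_pairs: "finite (bichromatic t)" "finite (monochromatic t)"
  by (rule finite_subset[of _ "V \<times> V"]; use finite_V in \<open>auto simp: bichromatic_def monochromatic_def\<close>)+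

text \<open>The \<open>card V - 2\<close> vectors other than \<open>a\<close> and \<open>b\<close>
  contribute odd terms, and these two contribute 0.\<close>

lemma even_imbalance:
  assumes "a \<in> V" "b \<in> V" "a \<noteq> b"
  shows "even (imbalance V a b - int (card V))"
proof -
  have fin: "finite (V - {a, b})" using finite_V by simp
  have "imbalance V a b = (\<Sum>c\<in>V - {a, b}. orient a b c)"
    unfolding imbalance_def by (rule sum.mono_neutral_right) (use finite_V in \<open>auto simp: orient_def\<close>)
  moreover have "even ((\<Sum>c\<in>V - {a, b}. orient a b c) - int (card (V - {a, b})))"
  proof -
    have "(\<Sum>c\<in>V - {a, b}. orient a b c) - int (card (V - {a, b})) = (\<Sum>c\<in>V - {a, b}. orient a b c - 1)"
      by (simp add: sum_subtractf)
    moreover have "even (\<Sum>c\<in>V - {a, b}. orient a b c - 1)"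
    proof (rule dvd_sum)
      fix c assume "c \<in> V - {a, b}"
      then show "even (orient a b c - 1)" using orient_cases[of a b c] assms by auto
    qed
    ultimately show ?thesis by simp
  qed
  moreover have "card V = card (V - {a, b}) + 2"
  proof -
    have "card {a, b} \<le> card V" using assms finite_V by (intro card_mono) auto
    then show ?thesis using assms finite_V by (simp add: card_Diff_subset)
  qed
  ultimately show ?thesis by simp
qed

text \<open>Choosing a witness for each bichromatic pair gives a map into the monochromatic pairs,
  injective by \<open>witness_inj\<close>. By parity every imbalance is congruent to
  \<open>t\<close> modulo 2, as \<open>exists_witness\<close> asks.\<close>

lemma card_bichromatic_le:
  assumes "1 \<le> t" "even (t - int (card V))"
  shows "card (bichromatic t) \<le> card (monochromatic t)"
proof -
  have "\<exists>q\<in>monochromatic t. witness t (fst p) (snd p) (fst q) (snd q)" if "p \<in> bichromatic t" for p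
  proof -
    obtain r b where p: "p = (r, b)" by force
    have rb: "r \<in> V" "0 < N \<bullet> r" "b \<in> V" "N \<bullet> b < 0" "t \<le> \<bar>imbalance V r b\<bar>"
      using that by (auto simp: p bichromatic_def)
    then have "even (imbalance V r b - int (card V))" by (intro even_imbalance) auto
    then have "even (imbalance V r b - t)" using assms(2) by presburger
    then obtain x y where xy: "x \<in> V" "y \<in> V" "x \<noteq> y" "t \<le> \<bar>imbalance V x y\<bar>" "witness t r b x y"
      using exists_witness[of r b t] rb assms by blast
    have "colour x = colour y"
      using xy(5) N_nz[OF xy(1)] N_nz[OF xy(2)] rb
      by (auto simp: witness_def match_def isgn_def split: if_splits)
    then show ?thesis using xy by (auto simp: p monochromatic_def intro!: bexI[of _ "(x, y)"])
  qed
  then obtain h where h: "\<And>p. p \<in> bichromatic t \<Longrightarrow> h p \<in> monochromatic t \<and> witness t (fst p) (snd p) (fst (h p)) (snd (h p))"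
    by metis
  have "inj_on h (bichromatic t)"
  proof (rule inj_onI)
    fix p q assume pq: "p \<in> bichromatic t" "q \<in> bichromatic t" "h p = h q"
    have "fst p = fst q \<and> snd p = snd q"
      by (rule witness_inj[of t _ _ "fst (h p)" "snd (h p)"])
        (use pq h[OF pq(1)] h[OF pq(2)] in \<open>auto simp: bichromatic_def monochromatic_def\<close>)
    then show "p = q" by (simp add: prod_eq_iff)
  qed
  moreover have "h ` bichromatic t \<subseteq> monochromatic t" using h by blast
  ultimately show ?thesis using finite_pairs by (meson card_inj_on_le)
qed

end

section \<open>Summation over the thresholds\<close>

text \<open>Telescoping over the thresholds \<open>t = \<epsilon> + 2 * j\<close> up to the absolute
  value of \<open>D\<close>: each adds \<open>t * t - (t - 2) * (t - 2) = 4 * (t - 1)\<close>, and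
  the square of \<open>\<epsilon>\<close> is \<open>\<epsilon>\<close>.\<close>

lemma square_layer_cake:
  fixes D \<epsilon> :: int
  assumes e: "\<epsilon> = 0 \<or> \<epsilon> = 1" and par: "even (D - \<epsilon>)" and K: "\<bar>D\<bar> \<le> \<epsilon> + 2 * int K"
  shows "D\<^sup>2 - \<epsilon> = (\<Sum>j = 1..K. if \<epsilon> + 2 * int j \<le> \<bar>D\<bar> then 4 * (\<epsilon> + 2 * int j - 1) else 0)"
  using K
proof (induction K)
  case 0
  then have "D = \<epsilon> \<or> D = - \<epsilon>" using e par by presburger
  then show ?case using e by auto
next
  case (Suc K)
  show ?case
  proof (cases "\<bar>D\<bar> \<le> \<epsilon> + 2 * int K")
    case True
    then show ?thesis using Suc.IH by simp
  next
    case False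
    then have D: "\<bar>D\<bar> = \<epsilon> + 2 * int (Suc K)" using Suc.prems par by presburger
    have all: "\<epsilon> + 2 * int j \<le> \<bar>D\<bar>" if "j \<in> {1..Suc K}" for j using that D by auto
    have "(\<Sum>j = 1..Suc K. if \<epsilon> + 2 * int j \<le> \<bar>D\<bar> then 4 * (\<epsilon> + 2 * int j - 1) else 0)
        = (\<Sum>j = 1..Suc K. 4 * (\<epsilon> + 2 * int j - 1))"
      by (rule sum.cong) (use all in auto)
    also have "\<dots> = (\<epsilon> + 2 * int (Suc K))\<^sup>2 - \<epsilon>\<^sup>2"
      by (induction K) (simp_all add: power2_eq_square algebra_simps)
    also have "(\<epsilon> + 2 * int (Suc K))\<^sup>2 = D\<^sup>2" unfolding D[symmetric] by simp
    also have "\<epsilon>\<^sup>2 = \<epsilon>" using e by auto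
    finally show ?thesis by simp
  qed
qed

lemma imbalance_swap: "imbalance V b a = - imbalance V a b"
  by (simp add: imbalance_def orient_def det3_swap[of b a] sum_negf)

context coloured_config
begin

lemma imbalance_le_card: "\<bar>imbalance V a b\<bar> \<le> int (card V)"
proof -
  have "\<bar>imbalance V a b\<bar> \<le> (\<Sum>c\<in>V. \<bar>orient a b c\<bar>)"
    unfolding imbalance_def by (rule sum_abs)
  also have "\<dots> \<le> (\<Sum>c\<in>V. 1)" by (rule sum_mono) (simp add: orient_def isgn_def)
  finally show ?thesis by simp
qed

definition off_diagonal :: "((real^3) \<times> (real^3)) set" where
  "off_diagonal = {(a, b). a \<in> V \<and> b \<in> V \<and> a \<noteq> b}"

definition weight :: "(real^3) \<times> (real^3) \<Rightarrow> int" where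
  "weight = (\<lambda>(a, b). 1 + 3 * colour a * colour b)"

lemma finite_off_diagonal: "finite off_diagonal"
  by (rule finite_subset[of _ "V \<times> V"]) (use finite_V in \<open>auto simp: off_diagonal_def\<close>)

text \<open>Red-blue pairs enter in both orders, as \<open>bichromatic t\<close> and its mirror
  image \<open>B'\<close>, each with weight -2. The sum is therefore 4 times the difference of the
  two cardinalities in \<open>card_bichromatic_le\<close>.\<close>

lemma weighted_count_nonneg:
  assumes "1 \<le> t" "even (t - int (card V))"
  shows "0 \<le> (\<Sum>(a, b)\<in>off_diagonal. weight (a, b) * (if t \<le> \<bar>imbalance V a b\<bar> then 1 else 0))"
proof -
  define B' where "B' = prod.swap ` bichromatic t"
  have card': "card B' = card (bichromatic t)" unfolding B'_def by (rule card_image) simp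
  have col: "colour a = 1 \<and> 0 < N \<bullet> a \<or> colour a = - 1 \<and> N \<bullet> a < 0" if "a \<in> V" for a
    using N_nz[OF that] by (auto simp: isgn_def)
  have ind: "weight p * (if t \<le> \<bar>imbalance V (fst p) (snd p)\<bar> then 1 else 0)
      = (if p \<in> monochromatic t then 4 else 0) + (if p \<in> bichromatic t then - 2 else 0) + (if p \<in> B' then - 2 else 0)"
    if p: "p \<in> off_diagonal" for p
  proof -
    obtain a b where ab: "p = (a, b)" by force
    have V: "a \<in> V" "b \<in> V" "a \<noteq> b" using p by (auto simp: ab off_diagonal_def)
    have "p \<in> B' \<longleftrightarrow> (b, a) \<in> bichromatic t" by (force simp: B'_def ab)
    then show ?thesis
      using col[OF V(1)] col[OF V(2)] V
      by (auto simp: ab weight_def monochromatic_def bichromatic_def imbalance_swap[of V a b])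
  qed
  have sub: "monochromatic t \<subseteq> off_diagonal" "bichromatic t \<subseteq> off_diagonal" "B' \<subseteq> off_diagonal"
    by (auto simp: monochromatic_def bichromatic_def off_diagonal_def B'_def)
  have "(\<Sum>(a, b)\<in>off_diagonal. weight (a, b) * (if t \<le> \<bar>imbalance V a b\<bar> then 1 else 0))
      = (\<Sum>p\<in>off_diagonal. (if p \<in> monochromatic t then 4 else 0) + (if p \<in> bichromatic t then - 2 else 0)
          + (if p \<in> B' then - 2 else 0))"
    by (rule sum.cong) (use ind in \<open>auto simp: split_beta\<close>)
  also have "\<dots> = 4 * int (card (monochromatic t)) - 2 * int (card (bichromatic t)) - 2 * int (card B')"
    using sub finite_off_diagonal by (simp add: sum.distrib sum.If_cases Int_absorb1)
  also have "\<dots> \<ge> 0" using card_bichromatic_le[OF assms] card' by simp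
  finally show ?thesis .
qed

text \<open>After the squares are split into layers and the sums exchanged, each threshold
  contributes a nonnegative coefficient times a nonnegative weighted count.\<close>

lemma weighted_square_sum_nonneg:
  fixes \<epsilon> :: int
  assumes e: "\<epsilon> = int (card V) mod 2"
  shows "0 \<le> (\<Sum>(a, b)\<in>off_diagonal. weight (a, b) * ((imbalance V a b)\<^sup>2 - \<epsilon>))"
proof -
  define K where "K = card V"
  have e01: "\<epsilon> = 0 \<or> \<epsilon> = 1" using e by presburger
  have sq: "(imbalance V a b)\<^sup>2 - \<epsilon>
      = (\<Sum>j = 1..K. if \<epsilon> + 2 * int j \<le> \<bar>imbalance V a b\<bar> then 4 * (\<epsilon> + 2 * int j - 1) else 0)"
    if "(a, b) \<in> off_diagonal" for a b
  proof (rule square_layer_cake[OF e01])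
    have "even (imbalance V a b - int (card V))"
      using that by (intro even_imbalance) (auto simp: off_diagonal_def)
    then show "even (imbalance V a b - \<epsilon>)" unfolding e by presburger
    show "\<bar>imbalance V a b\<bar> \<le> \<epsilon> + 2 * int K" using imbalance_le_card[of a b] e01 by (auto simp: K_def)
  qed
  have "(\<Sum>(a, b)\<in>off_diagonal. weight (a, b) * ((imbalance V a b)\<^sup>2 - \<epsilon>))
      = (\<Sum>(a, b)\<in>off_diagonal. \<Sum>j = 1..K. 4 * (\<epsilon> + 2 * int j - 1)
           * (weight (a, b) * (if \<epsilon> + 2 * int j \<le> \<bar>imbalance V a b\<bar> then 1 else 0)))"
    by (rule sum.cong) (auto simp: sq sum_distrib_left intro!: sum.cong)
  also have "\<dots> = (\<Sum>j = 1..K. 4 * (\<epsilon> + 2 * int j - 1)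
      * (\<Sum>(a, b)\<in>off_diagonal. weight (a, b) * (if \<epsilon> + 2 * int j \<le> \<bar>imbalance V a b\<bar> then 1 else 0)))"
    unfolding split_beta sum_distrib_left by (rule sum.swap)
  also have "\<dots> \<ge> 0"
  proof (rule sum_nonneg)
    fix j assume j: "j \<in> {1..K}"
    have "even (\<epsilon> + 2 * int j - int (card V))" unfolding e by presburger
    then show "0 \<le> 4 * (\<epsilon> + 2 * int j - 1)
      * (\<Sum>(a, b)\<in>off_diagonal. weight (a, b) * (if \<epsilon> + 2 * int j \<le> \<bar>imbalance V a b\<bar> then 1 else 0))"
      using weighted_count_nonneg[of "\<epsilon> + 2 * int j"] j e01 by (intro mult_nonneg_nonneg) auto
  qed
  finally show ?thesis .
qed

end

section \<open>The crossing identity\<close>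

definition tuple_sum :: "'a set \<Rightarrow> ('a \<Rightarrow> 'a \<Rightarrow> 'a \<Rightarrow> 'a \<Rightarrow> int) \<Rightarrow> int" where
  "tuple_sum V f = (\<Sum>a\<in>V. \<Sum>b\<in>V. \<Sum>c\<in>V. \<Sum>d\<in>V. if distinct [a, b, c, d] then f a b c d else 0)"

lemma tuple_sum_cong:
  assumes "\<And>a b c d. \<lbrakk>a \<in> V; b \<in> V; c \<in> V; d \<in> V; distinct [a, b, c, d]\<rbrakk> \<Longrightarrow> f a b c d = g a b c d"
  shows "tuple_sum V f = tuple_sum V g"
  unfolding tuple_sum_def by (intro sum.cong refl) (use assms in auto)

lemma tuple_sum_add: "tuple_sum V (\<lambda>a b c d. f a b c d + g a b c d) = tuple_sum V f + tuple_sum V g"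
  unfolding tuple_sum_def sum.distrib[symmetric] by (intro sum.cong refl) auto

lemma tuple_sum_cmult: "tuple_sum V (\<lambda>a b c d. k * f a b c d) = k * tuple_sum V f"
  unfolding tuple_sum_def sum_distrib_left by (intro sum.cong refl) auto

lemma tuple_sum_swap:
  "tuple_sum V (\<lambda>a b c d. f b a c d) = tuple_sum V f"
  "tuple_sum V (\<lambda>a b c d. f a c b d) = tuple_sum V f"
  "tuple_sum V (\<lambda>a b c d. f a b d c) = tuple_sum V f"
proof -
  show "tuple_sum V (\<lambda>a b c d. f b a c d) = tuple_sum V f"
    unfolding tuple_sum_def by (subst sum.swap) (intro sum.cong refl, auto)
  show "tuple_sum V (\<lambda>a b c d. f a c b d) = tuple_sum V f"
    unfolding tuple_sum_def by (rule sum.cong[OF refl], subst sum.swap) (intro sum.cong refl, auto)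
  show "tuple_sum V (\<lambda>a b c d. f a b d c) = tuple_sum V f"
    unfolding tuple_sum_def by (rule sum.cong[OF refl], rule sum.cong[OF refl], subst sum.swap)
      (intro sum.cong refl, auto)
qed

text \<open>In the six terms each of the six pairs from \<open>a, b, c, d\<close> takes the first
  two places once. Renaming the summation variables shows that all six sums agree.\<close>

lemma tuple_sum_pairs:
  "tuple_sum V (\<lambda>a b c d. f a b c d + f c d a b + f a c b d + f b d a c + f a d b c + f b c a d) = 6 * tuple_sum V f"
proof -
  have 2: "tuple_sum V (\<lambda>a b c d. f a d b c) = tuple_sum V f"
    using tuple_sum_swap(3)[of V "\<lambda>a b c d. f a c b d"] tuple_sum_swap(2)[of V f] by simp
  have 3: "tuple_sum V (\<lambda>a b c d. f b c a d) = tuple_sum V f"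
    using tuple_sum_swap(1)[of V "\<lambda>a b c d. f a c b d"] tuple_sum_swap(2)[of V f] by simp
  have 4: "tuple_sum V (\<lambda>a b c d. f b d a c) = tuple_sum V f"
    using tuple_sum_swap(1)[of V "\<lambda>a b c d. f a d b c"] 2 by simp
  have 5: "tuple_sum V (\<lambda>a b c d. f c d a b) = tuple_sum V f"
    using tuple_sum_swap(2)[of V "\<lambda>a b c d. f b d a c"] 4 by simp
  show ?thesis
    unfolding tuple_sum_add tuple_sum_swap(2)[of V f] 2 3 4 5 by simp
qed

text \<open>In \<open>det3_linear_dependence\<close> the coefficients of \<open>a\<close> and
  \<open>b\<close> have one sign and those of \<open>c\<close> and \<open>d\<close> the opposite
  one.\<close>

definition crossing_signs :: "real^3 \<Rightarrow> real^3 \<Rightarrow> real^3 \<Rightarrow> real^3 \<Rightarrow> bool" where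
  "crossing_signs a b c d \<longleftrightarrow>
     orient b c d = - orient a c d \<and> orient a b d = - orient a b c \<and> orient b c d \<noteq> orient a b d"

text \<open>With \<open>p, q, r, s\<close> the orientations of \<open>abc, abd, acd, bcd\<close>, the linear dependence of
  \<open>a, b, c, d\<close> has coefficients of signs \<open>s, -r, q, -p\<close>. The last assumption excludes that the inner
  products of \<open>N\<close> with the four terms of the dependence, which add up to 0, all have the same sign.\<close>

lemma sign_identity:
  fixes p q r s sa sb sc sd :: int
  assumes "p = 1 \<or> p = - 1" "q = 1 \<or> q = - 1" "r = 1 \<or> r = - 1" "s = 1 \<or> s = - 1"
    and "sa = 1 \<or> sa = - 1" "sb = 1 \<or> sb = - 1" "sc = 1 \<or> sc = - 1" "sd = 1 \<or> sd = - 1"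
    and "\<not> (sa * s = - sb * r \<and> sa * s = sc * q \<and> sa * s = - sd * p)"
  shows "16 * ((if s = - r \<and> q = - p \<and> s \<noteq> q then 1 else 0)
      + (if s = q \<and> r = p \<and> s \<noteq> - r then 1 else 0) + (if s = - p \<and> q = - r \<and> s \<noteq> q then 1 else 0))
    = 6 * (1 - sa * sb * sc * sd) + 2 * ((1 + 3 * sa * sb) * (q * p) - (1 + 3 * sc * sd) * (- (s * r))
      - (1 + 3 * sa * sc) * (r * p) - (1 + 3 * sb * sd) * (s * q)
      - (1 + 3 * sa * sd) * (- (r * q)) - (1 + 3 * sb * sc) * (- (s * p)))"
  using assms by (elim disjE; simp)

lemma sum_avoiding_two:
  fixes k :: "'a \<Rightarrow> int"
  assumes "finite V" "a \<in> V" "b \<in> V" "a \<noteq> b"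
  shows "(\<Sum>c\<in>V. if c \<noteq> a \<and> c \<noteq> b then k c else 0) = sum k V - k a - k b"
proof -
  have "(\<Sum>c\<in>V. if c \<noteq> a \<and> c \<noteq> b then k c else 0)
      = (\<Sum>c\<in>V. k c - (if c = a then k c else 0) - (if c = b then k c else 0))"
    by (rule sum.cong) (use assms(4) in auto)
  then show ?thesis using assms by (simp add: sum_subtractf)
qed

text \<open>The sum is 24 times the fourth elementary symmetric polynomial of the signs. The
  variables are summed out one at a time, subtracting the excluded indices and using that squares
  are 1. Constant \<open>u = 1\<close> yields the number of quadruples.\<close>

lemma tuple_sum_signs:
  fixes u :: "'a \<Rightarrow> int"
  assumes fin: "finite V" and sq: "\<And>v. v \<in> V \<Longrightarrow> u v * u v = 1"
  defines "n \<equiv> int (card V)" and "e \<equiv> sum u V"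
  shows "tuple_sum V (\<lambda>a b c d. u a * u b * u c * u d)
       = (e * e - n) * (e * e + 4 - n) - 4 * (n - 1) * e * e + 2 * n * (n - 1)"
proof -
  have inner: "(\<Sum>d\<in>V. if distinct [a, b, c, d] then u a * u b * u c * u d else 0)
      = (if a \<noteq> b then if c \<noteq> a \<and> c \<noteq> b then u a * u b * ((e - u a - u b) * u c - 1) else 0 else 0)"
    if V: "a \<in> V" "b \<in> V" "c \<in> V" for a b c
  proof (cases "distinct [a, b, c]")
    case True
    have "(\<Sum>d\<in>V. if distinct [a, b, c, d] then u a * u b * u c * u d else 0)
        = (\<Sum>d\<in>V. u a * u b * u c * (u d - (if d = a then u d else 0) - (if d = b then u d else 0) - (if d = c then u d else 0)))"
      by (rule sum.cong) (use True in auto)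
    also have "\<dots> = u a * u b * u c * (e - u a - u b - u c)"
      unfolding sum_distrib_left[symmetric] sum_subtractf using fin V by (simp add: e_def)
    also have "\<dots> = u a * u b * ((e - u a - u b) * u c - u c * u c)"
      by (simp add: algebra_simps)
    finally show ?thesis using True sq[OF V(3)] by auto
  qed auto
  have middle: "(\<Sum>c\<in>V. \<Sum>d\<in>V. if distinct [a, b, c, d] then u a * u b * u c * u d else 0)
      = (if a \<noteq> b then (e * e + 4 - n) * (u a * u b) - 2 * e * (u a + u b) + 2 else 0)"
    if V: "a \<in> V" "b \<in> V" for a b
  proof (cases "a = b")
    case False
    have "(\<Sum>c\<in>V. \<Sum>d\<in>V. if distinct [a, b, c, d] then u a * u b * u c * u d else 0)
        = (\<Sum>c\<in>V. if c \<noteq> a \<and> c \<noteq> b then u a * u b * ((e - u a - u b) * u c - 1) else 0)"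
    proof (rule sum.cong[OF refl])
      fix c assume "c \<in> V"
      from inner[OF V this] False
      show "(\<Sum>d\<in>V. if distinct [a, b, c, d] then u a * u b * u c * u d else 0)
          = (if c \<noteq> a \<and> c \<noteq> b then u a * u b * ((e - u a - u b) * u c - 1) else 0)"
        by (simp only: simp_thms if_True)
    qed
    also have "\<dots> = (\<Sum>c\<in>V. u a * u b * ((e - u a - u b) * u c - 1))
        - u a * u b * ((e - u a - u b) * u a - 1) - u a * u b * ((e - u a - u b) * u b - 1)"
      by (rule sum_avoiding_two[OF fin V False])
    also have "(\<Sum>c\<in>V. u a * u b * ((e - u a - u b) * u c - 1)) = u a * u b * ((e - u a - u b) * e - n)"
      unfolding sum_distrib_left[symmetric] sum_subtractf by (simp add: e_def n_def)
    finally have "(\<Sum>c\<in>V. \<Sum>d\<in>V. if distinct [a, b, c, d] then u a * u b * u c * u d else 0)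
      = u a * u b * ((e - u a - u b) * e - n)
        - u a * u b * ((e - u a - u b) * u a - 1) - u a * u b * ((e - u a - u b) * u b - 1)" .
    also have "\<dots> = (e * e + 2 - n) * (u a * u b) - 2 * e * ((u a * u a) * u b + u a * (u b * u b))
        + (u a * u a) * (u a * u b) + (u a * u b) * (u b * u b) + 2 * ((u a * u a) * (u b * u b))"
      by (simp add: algebra_simps)
    also have "\<dots> = (e * e + 4 - n) * (u a * u b) - 2 * e * (u a + u b) + 2"
      unfolding sq[OF V(1)] sq[OF V(2)] by (simp add: algebra_simps)
    finally show ?thesis using False by simp
  qed simp
  have "tuple_sum V (\<lambda>a b c d. u a * u b * u c * u d)
      = (\<Sum>a\<in>V. \<Sum>b\<in>V. ((e * e + 4 - n) * (u a * u b) - 2 * e * (u a + u b) + 2)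
          - (if a = b then (e * e + 4 - n) * (u a * u a) - 4 * e * u a + 2 else 0))"
    unfolding tuple_sum_def
  proof (intro sum.cong refl)
    fix a b assume V: "a \<in> V" "b \<in> V"
    show "(\<Sum>c\<in>V. \<Sum>d\<in>V. if distinct [a, b, c, d] then u a * u b * u c * u d else 0)
        = ((e * e + 4 - n) * (u a * u b) - 2 * e * (u a + u b) + 2)
          - (if a = b then (e * e + 4 - n) * (u a * u a) - 4 * e * u a + 2 else 0)"
      unfolding middle[OF V] by auto
  qed
  also have "\<dots> = (\<Sum>a\<in>V. (e * e + 4 - n) * (u a * e) - 2 * e * (n * u a + e) + 2 * n
      - ((e * e + 4 - n) * (u a * u a) - 4 * e * u a + 2))"
    by (rule sum.cong[OF refl])
      (simp add: sum_subtractf sum.distrib fin sum_distrib_left[symmetric] n_def e_def)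
  also have "\<dots> = (\<Sum>a\<in>V. ((e * e + 4 - n) * e - 2 * e * n + 4 * e) * u a
      + (2 * n - 2 * e * e - (e * e + 4 - n) - 2))"
    by (rule sum.cong[OF refl]) (simp add: sq algebra_simps)
  also have "\<dots> = ((e * e + 4 - n) * e - 2 * e * n + 4 * e) * e + n * (2 * n - 2 * e * e - (e * e + 4 - n) - 2)"
    by (simp add: sum.distrib sum_distrib_left[symmetric] n_def e_def)
  also have "\<dots> = (e * e - n) * (e * e + 4 - n) - 4 * (n - 1) * e * e + 2 * n * (n - 1)"
    by (simp add: algebra_simps)
  finally show ?thesis .
qed

context coloured_config
begin

lemma colour_square: "v \<in> V \<Longrightarrow> colour v * colour v = 1"
  using isgn_cases[OF N_nz, of v] by auto

text \<open>Pairing the linear dependence with \<open>N\<close> gives four nonzero reals with sum 0,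
  which cannot all have the same sign.\<close>

lemma dependence_signs_not_constant:
  assumes V: "a \<in> V" "b \<in> V" "c \<in> V" "d \<in> V" and dist: "distinct [a, b, c, d]"
  shows "\<not> (colour a * orient b c d = - colour b * orient a c d \<and> colour a * orient b c d = colour c * orient a b d
     \<and> colour a * orient b c d = - colour d * orient a b c)"
proof
  define x1 where "x1 = (N \<bullet> a) * det3 b c d"
  define x2 where "x2 = - ((N \<bullet> b) * det3 a c d)"
  define x3 where "x3 = (N \<bullet> c) * det3 a b d"
  define x4 where "x4 = - ((N \<bullet> d) * det3 a b c)"
  assume "colour a * orient b c d = - colour b * orient a c d \<and> colour a * orient b c d = colour c * orient a b d
     \<and> colour a * orient b c d = - colour d * orient a b c"
  then have eq: "isgn x1 = isgn x2" "isgn x1 = isgn x3" "isgn x1 = isgn x4"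
    by (simp_all add: x1_def x2_def x3_def x4_def orient_def isgn_mult)
  have "N \<bullet> (det3 b c d *\<^sub>R a - det3 a c d *\<^sub>R b + det3 a b d *\<^sub>R c - det3 a b c *\<^sub>R d) = 0"
    by (simp only: det3_linear_dependence inner_zero_right)
  then have "x1 + x2 + x3 + x4 = 0"
    by (simp add: x1_def x2_def x3_def x4_def inner_add_right inner_diff_right algebra_simps)
  moreover have "x1 \<noteq> 0" using N_nz[OF V(1)] det3_nz[OF V(2-4)] dist by (simp add: x1_def)
  ultimately show False using eq by (auto simp: isgn_def split: if_splits)
qed

text \<open>The identity fails for single quadruples, but \<open>sign_identity\<close> gives it
  after adding the six choices of the first pair, and \<open>tuple_sum_pairs\<close> undoes this
  symmetrization.\<close>

lemma crossing_sign_sum: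
  "8 * tuple_sum V (\<lambda>a b c d. if crossing_signs a b c d then 1 else 0)
   = tuple_sum V (\<lambda>a b c d. 1 - colour a * colour b * colour c * colour d)
   + 2 * tuple_sum V (\<lambda>a b c d. (1 + 3 * colour a * colour b) * (orient a b c * orient a b d))"
proof -
  define G where "G a b c d = 8 * (if crossing_signs a b c d then 1 else 0)
    + (- 1) * (1 - colour a * colour b * colour c * colour d)
    + (- 2) * ((1 + 3 * colour a * colour b) * (orient a b c * orient a b d))" for a b c d
  have "G a b c d + G c d a b + G a c b d + G b d a c + G a d b c + G b c a d = 0"
    if V: "a \<in> V" "b \<in> V" "c \<in> V" "d \<in> V" and dist: "distinct [a, b, c, d]" for a b c d
  proof -
    have norm:
      "orient d a b = orient a b d" "orient c a b = orient a b c" "orient c d a = orient a c d"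
      "orient c d b = orient b c d" "orient c b d = - orient b c d" "orient a c b = - orient a b c"
      "orient d a c = orient a c d" "orient b a c = - orient a b c" "orient b d c = - orient b c d"
      "orient b d a = orient a b d" "orient d b c = orient b c d" "orient a d c = - orient a c d"
      "orient a d b = - orient a b d" "orient c a d = - orient a c d" "orient b a d = - orient a b d"
      "orient b c a = orient a b c"
      unfolding orient_def isgn_simps(2)[symmetric]
      by (rule arg_cong[where f = isgn], simp add: det3_expand)+
    define p q r s where pqrs: "p = orient a b c" "q = orient a b d" "r = orient a c d" "s = orient b c d"
    have pm: "p = 1 \<or> p = - 1" "q = 1 \<or> q = - 1" "r = 1 \<or> r = - 1" "s = 1 \<or> s = - 1"
      unfolding pqrs using orient_cases V dist by auto
    have cpm: "colour v = 1 \<or> colour v = - 1" if "v \<in> V" for v by (rule isgn_cases[OF N_nz[OF that]])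
    have nc: "\<not> (colour a * s = - colour b * r \<and> colour a * s = colour c * q \<and> colour a * s = - colour d * p)"
      using dependence_signs_not_constant[OF V dist] unfolding pqrs .
    have X: "crossing_signs a b c d \<longleftrightarrow> s = - r \<and> q = - p \<and> s \<noteq> q"
      "crossing_signs c d a b \<longleftrightarrow> s = - r \<and> q = - p \<and> s \<noteq> q"
      "crossing_signs a c b d \<longleftrightarrow> s = q \<and> r = p \<and> s \<noteq> - r"
      "crossing_signs b d a c \<longleftrightarrow> s = q \<and> r = p \<and> s \<noteq> - r"
      "crossing_signs a d b c \<longleftrightarrow> s = - p \<and> q = - r \<and> s \<noteq> q"
      "crossing_signs b c a d \<longleftrightarrow> s = - p \<and> q = - r \<and> s \<noteq> q"
      unfolding crossing_signs_def norm pqrs[symmetric] by auto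
    show ?thesis
      using sign_identity[OF pm cpm[OF V(1)] cpm[OF V(2)] cpm[OF V(3)] cpm[OF V(4)] nc]
      unfolding G_def X norm pqrs[symmetric] by (simp add: algebra_simps)
  qed
  then have "tuple_sum V (\<lambda>a b c d. G a b c d + G c d a b + G a c b d + G b d a c + G a d b c + G b c a d)
      = tuple_sum V (\<lambda>a b c d. 0)"
    by (rule tuple_sum_cong)
  then have "tuple_sum V G = 0" unfolding tuple_sum_pairs by (simp add: tuple_sum_def)
  then show ?thesis unfolding G_def tuple_sum_add tuple_sum_cmult by simp
qed

text \<open>The sum over all \<open>c\<close>, \<open>d\<close> is the square of the imbalance; the
  excluded terms with \<open>c = d\<close> are 1 for \<open>card V - 2\<close> vectors and 0 for
  \<open>a\<close> and \<open>b\<close>.\<close>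

lemma orient_pair_sum:
  assumes V: "a \<in> V" "b \<in> V" "a \<noteq> b"
  shows "(\<Sum>c\<in>V. \<Sum>d\<in>V. if distinct [a, b, c, d] then orient a b c * orient a b d else 0)
     = (imbalance V a b)\<^sup>2 - (int (card V) - 2)"
proof -
  have sq: "orient a b c * orient a b c = (if c \<noteq> a \<and> c \<noteq> b then 1 else 0)" if "c \<in> V" for c
    using orient_cases[OF V(1,2) that] V by (auto simp: orient_def)
  have "(\<Sum>c\<in>V. \<Sum>d\<in>V. if distinct [a, b, c, d] then orient a b c * orient a b d else 0)
      = (\<Sum>c\<in>V. \<Sum>d\<in>V. orient a b c * orient a b d - (if d = c then orient a b d * orient a b d else 0))"
    by (intro sum.cong refl) (use V in \<open>auto simp: orient_def\<close>)
  also have "\<dots> = (\<Sum>c\<in>V. orient a b c * imbalance V a b - (if c \<noteq> a \<and> c \<noteq> b then 1 else 0))"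
    by (rule sum.cong[OF refl])
      (simp add: sum_subtractf finite_V sq imbalance_def sum_distrib_left)
  also have "\<dots> = imbalance V a b * imbalance V a b - (int (card V) - 2)"
    using sum_avoiding_two[OF finite_V V, of "\<lambda>_. 1"]
    by (simp add: sum_subtractf imbalance_def sum_distrib_right)
  finally show ?thesis by (simp add: power2_eq_square)
qed

lemma sum_off_diagonal:
  "(\<Sum>(a, b)\<in>off_diagonal. f a b) = (\<Sum>a\<in>V. \<Sum>b\<in>V. if a \<noteq> b then f a b else 0)" for f :: "_ \<Rightarrow> _ \<Rightarrow> int"
proof -
  have "(\<Sum>a\<in>V. \<Sum>b\<in>V. if a \<noteq> b then f a b else 0) = (\<Sum>p\<in>V \<times> V. if fst p \<noteq> snd p then f (fst p) (snd p) else 0)"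
    by (simp add: sum.cartesian_product split_beta)
  also have "\<dots> = (\<Sum>p\<in>{p \<in> V \<times> V. fst p \<noteq> snd p}. f (fst p) (snd p))"
    by (rule sum.inter_filter[symmetric]) (simp add: finite_V)
  also have "{p \<in> V \<times> V. fst p \<noteq> snd p} = off_diagonal" by (auto simp: off_diagonal_def)
  finally show ?thesis by (simp add: split_beta)
qed

lemma weighted_orient_sum:
  "tuple_sum V (\<lambda>a b c d. (1 + 3 * colour a * colour b) * (orient a b c * orient a b d))
   = (\<Sum>(a, b)\<in>off_diagonal. weight (a, b) * ((imbalance V a b)\<^sup>2 - (int (card V) - 2)))"
  unfolding sum_off_diagonal tuple_sum_def
proof (intro sum.cong refl)
  fix a b assume V: "a \<in> V" "b \<in> V"
  have "(\<Sum>c\<in>V. \<Sum>d\<in>V. if distinct [a, b, c, d] then (1 + 3 * colour a * colour b) * (orient a b c * orient a b d) else 0)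
      = weight (a, b) * (\<Sum>c\<in>V. \<Sum>d\<in>V. if distinct [a, b, c, d] then orient a b c * orient a b d else 0)"
    unfolding sum_distrib_left by (intro sum.cong refl) (simp add: weight_def)
  then show "(\<Sum>c\<in>V. \<Sum>d\<in>V. if distinct [a, b, c, d] then (1 + 3 * colour a * colour b) * (orient a b c * orient a b d) else 0)
      = (if a \<noteq> b then weight (a, b) * ((imbalance V a b)\<^sup>2 - (int (card V) - 2)) else 0)"
    using orient_pair_sum[OF V] by (cases "a = b") auto
qed

lemma weight_sum:
  defines "n \<equiv> int (card V)" and "e \<equiv> \<Sum>v\<in>V. colour v"
  shows "(\<Sum>(a, b)\<in>off_diagonal. weight (a, b)) = n * (n - 1) + 3 * (e * e - n)"
proof -
  have "(\<Sum>(a, b)\<in>off_diagonal. weight (a, b)) = (\<Sum>a\<in>V. \<Sum>b\<in>V. (1 + 3 * (colour a * colour b)) - (if b = a then 4 else 0))"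
    unfolding sum_off_diagonal by (intro sum.cong refl) (auto simp: weight_def colour_square mult.assoc)
  also have "\<dots> = (\<Sum>a\<in>V. n + 3 * (colour a * e) - 4)"
    by (rule sum.cong[OF refl]) (simp add: sum_subtractf sum.distrib finite_V sum_distrib_left[symmetric] n_def e_def)
  also have "\<dots> = n * n + 3 * (e * e) - 4 * n"
    by (simp add: sum_subtractf sum.distrib sum_distrib_left[symmetric] sum_distrib_right[symmetric] n_def e_def)
  finally show ?thesis by (simp add: algebra_simps)
qed

text \<open>The free shift \<open>\<epsilon>\<close> moves a multiple of the total weight into the
  constant part. With \<open>\<epsilon> = n mod 2\<close> the remaining sum is the one in
  \<open>weighted_square_sum_nonneg\<close>.\<close>

lemma crossing_identity:
  defines "n \<equiv> int (card V)" and "e \<equiv> \<Sum>v\<in>V. colour v"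
  shows "8 * tuple_sum V (\<lambda>a b c d. if crossing_signs a b c d then 1 else 0)
    = n * (n - 1) * (n - 2) * (n - 3)
      - ((e * e - n) * (e * e + 4 - n) - 4 * (n - 1) * e * e + 2 * n * (n - 1))
      + 2 * (\<epsilon> - (n - 2)) * (n * (n - 1) + 3 * (e * e - n))
      + 2 * (\<Sum>(a, b)\<in>off_diagonal. weight (a, b) * ((imbalance V a b)\<^sup>2 - \<epsilon>))"
proof -
  have one: "tuple_sum V (\<lambda>a b c d. 1) = n * (n - 1) * (n - 2) * (n - 3)"
    using tuple_sum_signs[OF finite_V, of "\<lambda>_. 1"] by (simp add: n_def algebra_simps)
  have "tuple_sum V (\<lambda>a b c d. 1 - colour a * colour b * colour c * colour d)
      = tuple_sum V (\<lambda>a b c d. 1 + (- 1) * (colour a * colour b * colour c * colour d))"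
    by simp
  also have "\<dots> = tuple_sum V (\<lambda>a b c d. 1) + (- 1) * tuple_sum V (\<lambda>a b c d. colour a * colour b * colour c * colour d)"
    unfolding tuple_sum_add tuple_sum_cmult ..
  also have "\<dots> = n * (n - 1) * (n - 2) * (n - 3)
      - ((e * e - n) * (e * e + 4 - n) - 4 * (n - 1) * e * e + 2 * n * (n - 1))"
    using one tuple_sum_signs[OF finite_V colour_square] by (simp add: n_def e_def)
  finally have A: "tuple_sum V (\<lambda>a b c d. 1 - colour a * colour b * colour c * colour d) = \<dots>" .
  define Q where "Q = (\<Sum>(a, b)\<in>off_diagonal. weight (a, b) * ((imbalance V a b)\<^sup>2 - \<epsilon>))"
  have "(\<Sum>(a, b)\<in>off_diagonal. weight (a, b) * ((imbalance V a b)\<^sup>2 - (n - 2)))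
      = (\<Sum>(a, b)\<in>off_diagonal. (\<epsilon> - (n - 2)) * weight (a, b) + weight (a, b) * ((imbalance V a b)\<^sup>2 - \<epsilon>))"
    by (rule sum.cong) (auto simp: algebra_simps)
  also have "\<dots> = (\<epsilon> - (n - 2)) * (\<Sum>(a, b)\<in>off_diagonal. weight (a, b)) + Q"
    by (simp add: sum.distrib sum_distrib_left split_beta Q_def)
  also have "(\<Sum>(a, b)\<in>off_diagonal. weight (a, b)) = n * (n - 1) + 3 * (e * e - n)"
    unfolding n_def e_def by (rule weight_sum)
  finally have B: "(\<Sum>(a, b)\<in>off_diagonal. weight (a, b) * ((imbalance V a b)\<^sup>2 - (n - 2)))
      = (\<epsilon> - (n - 2)) * (n * (n - 1) + 3 * (e * e - n)) + Q" .
  show ?thesis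
    unfolding crossing_sign_sum A weighted_orient_sum n_def[symmetric] B Q_def[symmetric]
    by (simp only: distrib_left mult.assoc add.assoc)
qed

end

text \<open>The constant part of \<open>crossing_identity\<close> for a halving plane, where the
  colour sum and \<open>\<epsilon>\<close> both equal \<open>k mod 2\<close>. In each parity class
  both sides are polynomials in one parameter.\<close>

lemma hill_constant:
  fixes m e :: int
  assumes m: "m = int k" and e: "e = int (k mod 2)" and k: "3 \<le> k"
  shows "m * (m - 1) * (m - 2) * (m - 3)
      - ((e * e - m) * (e * e + 4 - m) - 4 * (m - 1) * e * e + 2 * m * (m - 1))
      + 2 * (e - (m - 2)) * (m * (m - 1) + 3 * (e * e - m))
    = 16 * int (k div 2) * int ((k - 1) div 2) * int ((k - 2) div 2) * int ((k - 3) div 2)"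
proof (cases "even k")
  case True
  then have "k = 2 * ((k - 4) div 2) + 4" using k by presburger
  then obtain i where i: "k = 2 * i + 4" by blast
  have "k div 2 = i + 2" "(k - 1) div 2 = i + 1" "(k - 2) div 2 = i + 1" "(k - 3) div 2 = i" "k mod 2 = 0"
    unfolding i by simp_all
  then show ?thesis unfolding m e by (simp only:) (simp add: i algebra_simps)
next
  case False
  then have "k = 2 * ((k - 3) div 2) + 3" using k by presburger
  then obtain i where i: "k = 2 * i + 3" by blast
  have "k div 2 = i + 1" "(k - 1) div 2 = i + 1" "(k - 2) div 2 = i" "(k - 3) div 2 = i" "k mod 2 = 1"
    unfolding i by simp_all
  then show ?thesis unfolding m e by (simp only:) (simp add: i algebra_simps)
qed

section \<open>Crossings of spherical arcs\<close>

text \<open>The shortest arc is shorter than \<open>pi\<close>, so it consists of the unit vectors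
  in the convex cone of its endpoints.\<close>

lemma spherical_arc_eq:
  assumes u: "norm u = 1" and v: "norm v = 1" and "u \<noteq> v" and "u \<noteq> - v"
  shows "spherical_arc u v = {x. norm x = 1 \<and> (\<exists>\<alpha>\<ge>0. \<exists>\<beta>\<ge>0. x = \<alpha> *\<^sub>R u + \<beta> *\<^sub>R v)}"
proof -
  have "shortest_great_circle_arc u v (spherical_arc u v)"
    unfolding spherical_arc_def by (rule theI'[OF ex1_shortest_great_circle_arc[OF assms]])
  then obtain L where L: "great_circle_arc u v L (spherical_arc u v)"
    and min: "\<And>L' A'. great_circle_arc u v L' A' \<Longrightarrow> L \<le> L'"
    unfolding shortest_great_circle_arc_def by blast
  then obtain e where L0: "0 \<le> L" "L < 2 * pi" and e: "norm e = 1" "u \<bullet> e = 0" "v = cos L *\<^sub>R u + sin L *\<^sub>R e"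
    and arc: "spherical_arc u v = (\<lambda>t. cos t *\<^sub>R u + sin t *\<^sub>R e) ` {0..L}"
    unfolding great_circle_arc_def by blast
  have "L \<noteq> 0" "L \<noteq> pi" using e(3) \<open>u \<noteq> v\<close> \<open>u \<noteq> - v\<close> by auto
  moreover have "L \<le> pi"
  proof (cases "L = 0")
    case False
    \<comment> \<open>The complementary arc of the same great circle, which leaves \<open>u\<close>
      in the opposite direction.\<close>
    have "great_circle_arc u v (2 * pi - L) ((\<lambda>t. cos t *\<^sub>R u + sin t *\<^sub>R (- e)) ` {0..2 * pi - L})"
      unfolding great_circle_arc_def using L0 e False
      by (intro conjI exI[of _ "- e"]) (auto simp: cos_diff sin_diff)
    from min[OF this] show ?thesis by simp
  qed simp
  ultimately have Lpi: "0 < L" "L < pi" using L0 by auto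
  have s: "sin L > 0" using Lpi by (simp add: sin_gt_zero)
  have nrm: "norm (x *\<^sub>R u + y *\<^sub>R e) = 1 \<longleftrightarrow> x\<^sup>2 + y\<^sup>2 = 1" for x y
    using u e(1,2) by (simp add: norm_eq_1 inner_add_left inner_add_right inner_commute power2_eq_square)
  show ?thesis
  proof (intro set_eqI iffI)
    fix x assume "x \<in> spherical_arc u v"
    then obtain t where t: "0 \<le> t" "t \<le> L" "x = cos t *\<^sub>R u + sin t *\<^sub>R e" unfolding arc by auto
    \<comment> \<open>Spherical linear interpolation; both coefficients are nonnegative because
      \<open>L < pi\<close>.\<close>
    have "x = (sin (L - t) / sin L) *\<^sub>R u + (sin t / sin L) *\<^sub>R v"
      unfolding t(3) e(3) sin_diff using s
      by (simp add: scaleR_add_right add_divide_distrib diff_divide_distrib algebra_simps)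
    moreover have "0 \<le> sin (L - t) / sin L" "0 \<le> sin t / sin L"
      using s t Lpi by (auto intro!: divide_nonneg_pos sin_ge_zero)
    ultimately show "x \<in> {x. norm x = 1 \<and> (\<exists>\<alpha>\<ge>0. \<exists>\<beta>\<ge>0. x = \<alpha> *\<^sub>R u + \<beta> *\<^sub>R v)}"
      using nrm[of "cos t" "sin t"] t(3) by auto
  next
    fix x assume "x \<in> {x. norm x = 1 \<and> (\<exists>\<alpha>\<ge>0. \<exists>\<beta>\<ge>0. x = \<alpha> *\<^sub>R u + \<beta> *\<^sub>R v)}"
    then obtain \<alpha> \<beta> where x: "norm x = 1" "0 \<le> \<alpha>" "0 \<le> \<beta>" "x = \<alpha> *\<^sub>R u + \<beta> *\<^sub>R v" by blast
    have xe: "x = (\<alpha> + \<beta> * cos L) *\<^sub>R u + (\<beta> * sin L) *\<^sub>R e"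
      unfolding x(4) e(3) by (simp add: algebra_simps)
    then have "(\<alpha> + \<beta> * cos L)\<^sup>2 + (\<beta> * sin L)\<^sup>2 = 1" using x(1) nrm by simp
    moreover have "0 \<le> \<beta> * sin L" using x(3) s by simp
    ultimately obtain t where t: "0 \<le> t" "t \<le> pi" "\<alpha> + \<beta> * cos L = cos t" "\<beta> * sin L = sin t"
      using sincos_total_pi by metis
    \<comment> \<open>Nonnegativity of \<open>\<alpha>\<close> is what keeps \<open>t\<close> from
      passing \<open>L\<close>.\<close>
    have "sin (L - t) = \<alpha> * sin L"
      unfolding sin_diff t(3)[symmetric] t(4)[symmetric] by (simp add: algebra_simps)
    then have "0 \<le> sin (L - t)" using x(2) s by simp
    moreover have "sin (t - L) = - sin (L - t)" by (metis minus_diff_eq sin_minus)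
    ultimately have "t \<le> L" using sin_gt_zero[of "t - L"] t(2) Lpi(1) by fastforce
    then show "x \<in> spherical_arc u v" unfolding arc xe t(3,4) using t(1) by auto
  qed
qed

lemma crossing_signs_sym:
  assumes "crossing_signs a b c d"
  shows "crossing_signs b a c d" and "crossing_signs a b d c" and "crossing_signs c d a b"
proof -
  have norm:
    "orient d a b = orient a b d" "orient c a b = orient a b c" "orient c d a = orient a c d"
    "orient c d b = orient b c d" "orient b a c = - orient a b c" "orient b d c = - orient b c d"
    "orient a d c = - orient a c d" "orient b a d = - orient a b d"
    unfolding orient_def isgn_simps(2)[symmetric]
    by (rule arg_cong[where f = isgn], simp add: det3_expand)+
  show "crossing_signs b a c d" and "crossing_signs a b d c" and "crossing_signs c d a b"
    using assms unfolding crossing_signs_def norm by auto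
qed

locale unit_config = vector_config +
  assumes unit: "v \<in> V \<Longrightarrow> norm v = 1"
begin

lemma spherical_arc_config:
  assumes "u \<in> V" "v \<in> V" "u \<noteq> v"
  shows "spherical_arc u v = {x. norm x = 1 \<and> (\<exists>\<alpha>\<ge>0. \<exists>\<beta>\<ge>0. x = \<alpha> *\<^sub>R u + \<beta> *\<^sub>R v)}"
proof (rule spherical_arc_eq)
  show "u \<noteq> - v" using cross3_nz[OF assms] by auto
qed (use assms unit in auto)

text \<open>A common point of the two arcs is a common vector of two cones, that is, a dependence of
  the four endpoints of sign pattern (+,+,-,-). Conversely, such a dependence gives a common vector,
  which is then normalized.\<close>

lemma arcs_cross_iff:
  assumes V: "a \<in> V" "b \<in> V" "c \<in> V" "d \<in> V" and dist: "distinct [a, b, c, d]"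
  shows "spherical_arc a b \<inter> spherical_arc c d \<noteq> {} \<longleftrightarrow> crossing_signs a b c d"
proof -
  have nz: "det3 b c d \<noteq> 0" "det3 a c d \<noteq> 0" "det3 a b d \<noteq> 0" "det3 a b c \<noteq> 0"
    using det3_nz V dist by auto
  have ab: "a \<noteq> b" and cd: "c \<noteq> d" using dist by auto
  note arcs = spherical_arc_config[OF V(1,2) ab] spherical_arc_config[OF V(3,4) cd]
  show ?thesis
  proof
    assume "spherical_arc a b \<inter> spherical_arc c d \<noteq> {}"
    then obtain x \<alpha> \<beta> \<gamma> \<delta> where x: "norm x = 1" "0 \<le> \<alpha>" "0 \<le> \<beta>" "0 \<le> \<gamma>" "0 \<le> \<delta>"
      "x = \<alpha> *\<^sub>R a + \<beta> *\<^sub>R b" "x = \<gamma> *\<^sub>R c + \<delta> *\<^sub>R d"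
      unfolding arcs by blast
    have x0: "x \<noteq> 0" using x(1) by auto
    have eq: "\<alpha> * (w \<bullet> a) + \<beta> * (w \<bullet> b) = \<gamma> * (w \<bullet> c) + \<delta> * (w \<bullet> d)" for w
      using arg_cong[OF x(6)[unfolded x(7)], of "(\<bullet>) w"] by (simp add: inner_add_right)
    \<comment> \<open>Pairing with a cross product of two endpoints removes these two and leaves a
      relation between two coefficients.\<close>
    have e1: "\<alpha> * det3 a c d + \<beta> * det3 b c d = 0"
      using eq[of "cross3 c d"] by (simp add: det3_def[symmetric] det3_rotate[of c d a] det3_rotate[of c d b])
    have e2: "\<gamma> * det3 a b c + \<delta> * det3 a b d = 0"
      using eq[of "cross3 a b"] by (simp add: det3_def[symmetric])
    have e3: "\<alpha> * det3 a b d + \<gamma> * det3 b c d = 0"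
      using eq[of "cross3 b d"] by (simp add: det3_def[symmetric] det3_expand algebra_simps)
    \<comment> \<open>If one coefficient vanished, the other one in the same representation would
      vanish too, and \<open>x\<close> would be 0.\<close>
    have "\<alpha> \<noteq> 0" using e1 nz(1) x0 x(6) by auto
    moreover have "\<beta> \<noteq> 0" using e1 nz(2) x0 x(6) by auto
    moreover have "\<gamma> \<noteq> 0" using e2 nz(3) x0 x(7) by auto
    moreover have "\<delta> \<noteq> 0" using e2 nz(4) x0 x(7) by auto
    ultimately have pos: "0 < \<alpha>" "0 < \<beta>" "0 < \<gamma>" "0 < \<delta>" using x by auto
    have opp: "isgn p = - isgn q" if "0 < m" "0 < k" "m * p + k * q = 0" for m k p q :: real
    proof -
      have "isgn (m * p) = isgn (- (k * q))" using that(3) by (simp add: add_eq_0_iff)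
      moreover have "isgn m = 1" "isgn k = 1" using that(1,2) by (simp_all add: isgn_def)
      ultimately show ?thesis by (simp add: isgn_mult)
    qed
    have "isgn (det3 b c d) \<noteq> 0" using nz(1) by simp
    then show "crossing_signs a b c d"
      unfolding crossing_signs_def orient_def
      using opp[OF pos(1,2) e1] opp[OF pos(3,4) e2] opp[OF pos(1,3) e3] by auto
  next
    assume cs: "crossing_signs a b c d"
    \<comment> \<open>Multiplying the dependence by this sign makes the coefficients of
      \<open>a\<close> and \<open>b\<close> positive.\<close>
    define s where "s = real_of_int (orient b c d)"
    have s: "s = 1 \<or> s = - 1" using isgn_cases[OF nz(1)] by (auto simp: s_def orient_def)
    have pos: "0 < s * det3 b c d" "0 < - (s * det3 a c d)" "0 < - (s * det3 a b d)" "0 < s * det3 a b c"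
      using cs nz unfolding crossing_signs_def orient_def s_def by (auto simp: isgn_def split: if_splits)
    define y where "y = (s * det3 b c d) *\<^sub>R a + (- (s * det3 a c d)) *\<^sub>R b"
    have y': "y = (- (s * det3 a b d)) *\<^sub>R c + (s * det3 a b c) *\<^sub>R d"
    proof -
      have "y - ((- (s * det3 a b d)) *\<^sub>R c + (s * det3 a b c) *\<^sub>R d)
          = s *\<^sub>R (det3 b c d *\<^sub>R a - det3 a c d *\<^sub>R b + det3 a b d *\<^sub>R c - det3 a b c *\<^sub>R d)"
        unfolding y_def by (simp add: algebra_simps)
      then show ?thesis by (simp add: det3_linear_dependence)
    qed
    have "cross3 b c \<bullet> y = (s * det3 b c d) * det3 a b c"
      unfolding y_def inner_add_right inner_scaleR_right det3_def[symmetric]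
      by (simp add: det3_rotate[of b c a])
    then have y0: "y \<noteq> 0" using pos(1) nz(4) by auto
    define x where "x = (1 / norm y) *\<^sub>R y"
    have nx: "norm x = 1" using y0 by (simp add: x_def)
    have x1: "x = (s * det3 b c d / norm y) *\<^sub>R a + (- (s * det3 a c d) / norm y) *\<^sub>R b"
    proof -
      have "x = (1 / norm y) *\<^sub>R ((s * det3 b c d) *\<^sub>R a + (- (s * det3 a c d)) *\<^sub>R b)"
        unfolding x_def using y_def by (rule arg_cong)
      then show ?thesis by (simp add: scaleR_diff_right)
    qed
    have x2: "x = (- (s * det3 a b d) / norm y) *\<^sub>R c + (s * det3 a b c / norm y) *\<^sub>R d"
    proof -
      have "x = (1 / norm y) *\<^sub>R ((- (s * det3 a b d)) *\<^sub>R c + (s * det3 a b c) *\<^sub>R d)"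
        unfolding x_def using y' by (rule arg_cong)
      then show ?thesis by (simp add: scaleR_diff_right)
    qed
    have nn: "0 \<le> s * det3 b c d / norm y" "0 \<le> - (s * det3 a c d) / norm y"
      "0 \<le> - (s * det3 a b d) / norm y" "0 \<le> s * det3 a b c / norm y"
      using pos by (intro divide_nonneg_nonneg; linarith?; simp)+
    have "x \<in> spherical_arc a b"
      unfolding arcs(1) mem_Collect_eq
      by (rule conjI[OF nx], rule exI, rule conjI[OF nn(1)], rule exI, rule conjI[OF nn(2) x1])
    moreover have "x \<in> spherical_arc c d"
      unfolding arcs(2) mem_Collect_eq
      by (rule conjI[OF nx], rule exI, rule conjI[OF nn(3)], rule exI, rule conjI[OF nn(4) x2])
    ultimately
    show "spherical_arc a b \<inter> spherical_arc c d \<noteq> {}" by blast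
  qed
qed

text \<open>A crossing is listed by 8 ordered quadruples: the ends of either edge and the two edges
  can be exchanged.\<close>

lemma eight_cr: "8 * int (cr V) = tuple_sum V (\<lambda>a b c d. if crossing_signs a b c d then 1 else 0)"
proof -
  define W where "W = {(a, b, c, d). a \<in> V \<and> b \<in> V \<and> c \<in> V \<and> d \<in> V \<and> distinct [a, b, c, d] \<and> crossing_signs a b c d}"
  define F where "F = (\<lambda>(a, b, c, d). {{a, b}, {c, d :: real^3}})"
  have "W \<subseteq> V \<times> V \<times> V \<times> V" by (auto simp: W_def)
  then have finW: "finite W" using finite_V by (meson finite_SigmaI finite_subset)
  have cross: "crossings V = F ` W"
  proof (intro set_eqI iffI)
    fix X assume "X \<in> crossings V"
    then obtain a b c d where X: "X = {{a, b}, {c, d}}" "{a, b, c, d} \<subseteq> V" "distinct [a, b, c, d]"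
      "spherical_arc a b \<inter> spherical_arc c d \<noteq> {}" unfolding crossings_def by blast
    then have V: "a \<in> V" "b \<in> V" "c \<in> V" "d \<in> V" by simp_all
    have "crossing_signs a b c d" using X(4) arcs_cross_iff[OF V X(3)] by simp
    then have "(a, b, c, d) \<in> W" using V X(3) by (simp add: W_def)
    moreover have "X = F (a, b, c, d)" using X(1) by (simp add: F_def)
    ultimately show "X \<in> F ` W" by (rule rev_image_eqI)
  next
    fix X assume "X \<in> F ` W"
    then obtain w where w: "w \<in> W" "X = F w" by (rule imageE)
    obtain a b c d where abcd: "w = (a, b, c, d)" by (cases w) auto
    have V: "a \<in> V" "b \<in> V" "c \<in> V" "d \<in> V" and dist: "distinct [a, b, c, d]" and cs: "crossing_signs a b c d"
      using w(1) by (simp_all add: W_def abcd)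
    have "spherical_arc a b \<inter> spherical_arc c d \<noteq> {}" using arcs_cross_iff[OF V dist] cs by simp
    moreover have "X = {{a, b}, {c, d}}" using w(2) by (simp add: F_def abcd)
    moreover have "{a, b, c, d} \<subseteq> V" using V by simp
    ultimately show "X \<in> crossings V" unfolding crossings_def using dist by blast
  qed
  have fibre: "card {w \<in> W. F w = F w0} = 8" if "w0 \<in> W" for w0
  proof -
    obtain a b c d where w0: "w0 = (a, b, c, d)" by (cases w0) auto
    have dist: "a \<noteq> b" "a \<noteq> c" "a \<noteq> d" "b \<noteq> c" "b \<noteq> d" "c \<noteq> d" using that by (auto simp: w0 W_def)
    have V: "a \<in> V" "b \<in> V" "c \<in> V" "d \<in> V" and cs1: "crossing_signs a b c d"
      using that by (auto simp: w0 W_def)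
    note cs2 = crossing_signs_sym(1)[OF cs1] and cs3 = crossing_signs_sym(2)[OF cs1] and cs4 = crossing_signs_sym(3)[OF cs1]
    note cs = cs1 cs2 cs3 cs4 crossing_signs_sym(2)[OF cs2] crossing_signs_sym(1)[OF cs4] crossing_signs_sym(2)[OF cs4]
      crossing_signs_sym(2)[OF crossing_signs_sym(1)[OF cs4]]
    define Z where "Z = {(a, b, c, d), (b, a, c, d), (a, b, d, c), (b, a, d, c),
       (c, d, a, b), (d, c, a, b), (c, d, b, a), (d, c, b, a)}"
    have "{w \<in> W. F w = F w0} = Z"
    proof (intro set_eqI iffI)
      fix w assume "w \<in> {w \<in> W. F w = F w0}"
      then show "w \<in> Z" by (cases w) (auto simp: F_def w0 doubleton_eq_iff Z_def)
    next
      fix w assume "w \<in> Z"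
      then have "w \<in> W" using V dist dist[symmetric] cs by (auto simp: Z_def W_def)
      moreover have "F w = F w0" using \<open>w \<in> Z\<close> by (auto simp: Z_def F_def w0 doubleton_eq_iff)
      ultimately show "w \<in> {w \<in> W. F w = F w0}" by simp
    qed
    moreover have "card Z = 8" unfolding Z_def using dist dist[symmetric] by simp
    ultimately show ?thesis by simp
  qed
  have "card W = (\<Sum>X\<in>F ` W. card {w \<in> W. F w = X})"
    unfolding card_eq_sum by (rule sum.image_gen[OF finW])
  also have "\<dots> = (\<Sum>X\<in>F ` W. 8)" by (rule sum.cong) (use fibre in auto)
  finally have "8 * int (cr V) = int (card W)" by (simp add: cr_def cross)
  also have "\<dots> = (\<Sum>w\<in>V \<times> V \<times> V \<times> V. if w \<in> W then 1 else 0)"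
  proof -
    have "(V \<times> V \<times> V \<times> V) \<inter> W = W" using \<open>W \<subseteq> _\<close> by blast
    then show ?thesis using finite_V by (simp add: sum.If_cases)
  qed
  also have "\<dots> = (\<Sum>a\<in>V. \<Sum>b\<in>V. \<Sum>c\<in>V. \<Sum>d\<in>V. if (a, b, c, d) \<in> W then 1 else 0)"
    by (simp only: sum.cartesian_product')
  also have "\<dots> = tuple_sum V (\<lambda>a b c d. if crossing_signs a b c d then 1 else 0)"
    unfolding tuple_sum_def
  proof (intro sum.cong refl)
    fix a b c d assume V: "a \<in> V" "b \<in> V" "c \<in> V" "d \<in> V"
    show "(if (a, b, c, d) \<in> W then 1 else 0)
        = (if distinct [a, b, c, d] then if crossing_signs a b c d then 1 else 0 else 0 :: int)"
      using V by (simp add: W_def)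
  qed
  finally show ?thesis .
qed

end

section \<open>A generic halving plane\<close>

text \<open>A vector that works for \<open>S\<close> is moved in the direction of the new element
  \<open>u\<close>; only finitely many step lengths create an orthogonality.\<close>

lemma exists_nonorthogonal:
  fixes S :: "(real^3) set"
  assumes "finite S" and "0 \<notin> S"
  shows "\<exists>x. \<forall>w\<in>S. x \<bullet> w \<noteq> 0"
  using assms
proof (induction S)
  case (insert u S)
  then obtain x where x: "\<forall>w\<in>S. x \<bullet> w \<noteq> 0" by auto
  obtain t :: real where t: "t \<notin> (\<lambda>w. - (x \<bullet> w) / (u \<bullet> w)) ` insert u S"
    using ex_new_if_finite[OF infinite_UNIV_char_0] insert.hyps(1) by (metis finite.insertI finite_imageI)
  have "(x + t *\<^sub>R u) \<bullet> w \<noteq> 0" if w: "w \<in> insert u S" for w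
  proof (cases "u \<bullet> w = 0")
    case True
    then have "w \<noteq> u" using insert.prems by auto
    then show ?thesis using x w True by (auto simp: inner_add_left)
  next
    case False
    have "t \<noteq> - (x \<bullet> w) / (u \<bullet> w)" using t w by blast
    then show ?thesis using False by (simp add: inner_add_left field_simps add_eq_0_iff)
  qed
  then show ?case by blast
qed simp

lemma general_position_config:
  assumes fin: "finite V" and card: "card V \<ge> 3" and gp: "general_position V"
  shows "vector_config V"
proof -
  have det: "det3 a b c \<noteq> 0" if V: "a \<in> V" "b \<in> V" "c \<in> V" and dist: "distinct [a, b, c]" for a b c
  proof
    assume "det3 a b c = 0"
    then have "dependent {a, b, c}" by (rule det3_zero_imp_dependent[OF dist])
    moreover have "card {a, b, c} = 3" using dist by auto
    ultimately show False using gp V unfolding general_position_def by (metis insert_subset empty_subsetI)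
  qed
  show ?thesis
  proof
    fix a b assume ab: "a \<in> V" "b \<in> V" "a \<noteq> b"
    \<comment> \<open>A third vector exists, and a nonzero determinant with it forces the cross
      product to be nonzero.\<close>
    have "\<not> V \<subseteq> {a, b}"
    proof
      assume "V \<subseteq> {a, b}"
      then have "card V \<le> card {a, b}" by (intro card_mono) auto
      then show False using card ab(3) by simp
    qed
    then obtain c where "c \<in> V" "c \<noteq> a" "c \<noteq> b" by blast
    then show "cross3 a b \<noteq> 0" using det[OF ab(1,2), of c] ab(3) by (auto simp: det3_def)
  qed (use fin det in auto)
qed

text \<open>Both open sides of the plane of \<open>a\<close> and \<open>b\<close> contain at least
  \<open>(card V - 2) div 2\<close> vectors and together at most \<open>card V - 2\<close>, so their
  sizes differ by at most the remainder.\<close>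

lemma coneighborly_imbalance:
  assumes "vector_config V" and cn: "coneighborly V" and ab: "a \<in> V" "b \<in> V" "a \<noteq> b"
  shows "\<bar>imbalance V a b\<bar> \<le> int (card V mod 2)"
proof -
  interpret vector_config V by fact
  define c where "c = cross3 a b"
  have c0: "c \<noteq> 0" using cross3_nz[OF ab] by (simp add: c_def)
  define P where "P = V \<inter> {x. 0 < c \<bullet> x}"
  define M where "M = V \<inter> {x. 0 < (- c) \<bullet> x}"
  have ge: "(card V - 2) div 2 \<le> card P" "(card V - 2) div 2 \<le> card M"
    using cn c0 unfolding coneighborly_def P_def M_def by (metis, metis neg_equal_0_iff_equal)
  have fin: "finite P" "finite M" using finite_V by (auto simp: P_def M_def)
  have "imbalance V a b = (\<Sum>v\<in>V. (if v \<in> P then 1 else 0) - (if v \<in> M then 1 else 0))"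
    unfolding imbalance_def by (rule sum.cong) (auto simp: orient_def isgn_def det3_def P_def M_def c_def)
  also have "\<dots> = int (card P) - int (card M)"
  proof -
    have "V \<inter> P = P" "V \<inter> M = M" by (auto simp: P_def M_def)
    then show ?thesis using finite_V by (simp add: sum_subtractf sum.If_cases)
  qed
  finally have imb: "imbalance V a b = int (card P) - int (card M)" .
  have "P \<union> M \<subseteq> V - {a, b}" by (auto simp: P_def M_def c_def dot_cross_self)
  then have "card (P \<union> M) \<le> card (V - {a, b})" using finite_V by (intro card_mono) auto
  also have "\<dots> = card V - 2" using ab finite_V by (simp add: card_Diff_subset)
  also have "card (P \<union> M) = card P + card M"
    by (rule card_Un_disjoint[OF fin]) (auto simp: P_def M_def)
  finally have "card P + card M \<le> card V - 2" .
  moreover have "2 \<le> card V"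
    using card_mono[OF finite_V, of "{a, b}"] ab by simp
  moreover from this have "card V - 2 = 2 * ((card V - 2) div 2) + card V mod 2"
    by (metis add_diff_cancel_left' le_Suc_ex mod_add_self1 mult.commute div_mult_mod_eq)
  ultimately have "card P + card M \<le> 2 * ((card V - 2) div 2) + card V mod 2" by simp
  then show ?thesis unfolding imb using ge by linarith
qed

text \<open>The plane normal to \<open>M - t *\<^sub>R K\<close> is turned by varying
  \<open>t\<close>. It passes \<open>v\<close> at \<open>t = X v\<close>, and these values are
  distinct, so the colour sum \<open>E t\<close> changes by 2 at a time between \<open>D\<close> and
  \<open>- D\<close>. It equals \<open>card V mod 2\<close> on some interval, where \<open>t\<close>
  can avoid the finitely many values that are bad for \<open>S\<close>.\<close>

lemma exists_balanced_generic:
  assumes "vector_config V" and S: "finite S" "0 \<notin> S" "V \<subseteq> S" and ne: "V \<noteq> {}"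
  shows "\<exists>N. (\<forall>w\<in>S. N \<bullet> w \<noteq> 0) \<and> (\<Sum>v\<in>V. isgn (N \<bullet> v)) = int (card V mod 2)"
proof -
  interpret vector_config V by fact
  obtain K where K: "\<And>w. w \<in> S \<Longrightarrow> K \<bullet> w \<noteq> 0" using exists_nonorthogonal[OF S(1,2)] by blast
  have KV: "K \<bullet> v \<noteq> 0" if "v \<in> V" for v using K that S(3) by blast
  \<comment> \<open>\<open>M\<close> is chosen not orthogonal to these vectors, which means exactly
    that \<open>X u\<close> and \<open>X v\<close> differ; they are nonzero since \<open>u\<close>
    and \<open>v\<close> are not parallel.\<close>
  define P where "P = (\<lambda>(u, v). (K \<bullet> u) *\<^sub>R v - (K \<bullet> v) *\<^sub>R u) ` {(u, v) \<in> V \<times> V. u \<noteq> v}"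
  have "0 \<notin> P"
  proof
    assume "0 \<in> P"
    then obtain u v where uv: "u \<in> V" "v \<in> V" "u \<noteq> v" "(K \<bullet> u) *\<^sub>R v - (K \<bullet> v) *\<^sub>R u = 0"
      unfolding P_def by auto
    have "cross3 u ((K \<bullet> u) *\<^sub>R v - (K \<bullet> v) *\<^sub>R u) = (K \<bullet> u) *\<^sub>R cross3 u v"
      by (simp add: Cross3.right_diff_distrib cross_mult_right)
    then have "(K \<bullet> u) *\<^sub>R cross3 u v = 0" unfolding uv(4) by simp
    then show False using KV[OF uv(1)] cross3_nz[OF uv(1-3)] by simp
  qed
  moreover have "finite P"
    unfolding P_def by (rule finite_imageI, rule finite_subset[of _ "V \<times> V"]) (use finite_V in auto)
  ultimately obtain M where M: "\<And>w. w \<in> P \<Longrightarrow> M \<bullet> w \<noteq> 0" using exists_nonorthogonal[of P] by blast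
  define X where "X v = (M \<bullet> v) / (K \<bullet> v)" for v
  have injX: "inj_on X V"
  proof (rule inj_onI, rule ccontr)
    fix u v assume uv: "u \<in> V" "v \<in> V" "X u = X v" "u \<noteq> v"
    have "(K \<bullet> u) *\<^sub>R v - (K \<bullet> v) *\<^sub>R u \<in> P" unfolding P_def using uv by (intro image_eqI[of _ _ "(u, v)"]) auto
    then have "M \<bullet> ((K \<bullet> u) *\<^sub>R v - (K \<bullet> v) *\<^sub>R u) \<noteq> 0" by (rule M)
    moreover have "(M \<bullet> u) * (K \<bullet> v) = (M \<bullet> v) * (K \<bullet> u)"
      using uv(3) KV[OF uv(1)] KV[OF uv(2)] by (simp add: X_def frac_eq_eq)
    ultimately show False by (simp add: inner_diff_right mult.commute)
  qed
  define \<sigma> where "\<sigma> v = isgn (K \<bullet> v)" for v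
  define E where "E t = (\<Sum>v\<in>V. \<sigma> v * isgn (X v - t))" for t
  have pm: "\<sigma> v = 1 \<or> \<sigma> v = - 1" if "v \<in> V" for v unfolding \<sigma>_def by (rule isgn_cases[OF KV[OF that]])
  have finish: ?thesis if lr: "l < r" and E: "\<And>t. l < t \<Longrightarrow> t < r \<Longrightarrow> E t = int (card V mod 2)" for l r
  proof -
    have "infinite ({l<..<r} - (\<lambda>w. (M \<bullet> w) / (K \<bullet> w)) ` S)"
      using lr S(1) by (intro Diff_infinite_finite) (auto simp: infinite_Ioo)
    then have "{l<..<r} - (\<lambda>w. (M \<bullet> w) / (K \<bullet> w)) ` S \<noteq> {}" by (rule infinite_imp_nonempty)
    then obtain t where "t \<in> {l<..<r} - (\<lambda>w. (M \<bullet> w) / (K \<bullet> w)) ` S" by blast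
    then have t: "l < t" "t < r" "t \<notin> (\<lambda>w. (M \<bullet> w) / (K \<bullet> w)) ` S" by simp_all
    define N where "N = M - t *\<^sub>R K"
    have nz: "N \<bullet> w \<noteq> 0" if "w \<in> S" for w
    proof
      assume "N \<bullet> w = 0"
      then have "t = (M \<bullet> w) / (K \<bullet> w)" using K[OF that] by (simp add: N_def inner_diff_left eq_divide_eq)
      then show False using t(3) that by blast
    qed
    have "(\<Sum>v\<in>V. isgn (N \<bullet> v)) = E t"
      unfolding E_def
    proof (rule sum.cong[OF refl])
      fix v assume "v \<in> V"
      then have "N \<bullet> v = (K \<bullet> v) * (X v - t)"
        using KV[of v] by (simp add: N_def X_def inner_diff_left right_diff_distrib mult.commute)
      then show "isgn (N \<bullet> v) = \<sigma> v * isgn (X v - t)" by (simp add: isgn_mult \<sigma>_def)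
    qed
    then have "(\<Sum>v\<in>V. isgn (N \<bullet> v)) = int (card V mod 2)" using E[OF t(1,2)] by simp
    then show ?thesis using nz by (intro exI[of _ N] conjI ballI)
  qed
  \<comment> \<open>At \<open>X v\<close> the vector \<open>v\<close> contributes 0 to
    \<open>E\<close>; close by, only this contribution changes.\<close>
  have near: "\<exists>\<delta>>0. \<forall>t. 0 < \<bar>t - X v\<bar> \<and> \<bar>t - X v\<bar> < \<delta> \<longrightarrow> E t = E (X v) + \<sigma> v * isgn (X v - t)"
    if v: "v \<in> V" for v
  proof -
    obtain \<delta> where d: "\<delta> > 0" "\<And>y. y \<in> X ` V \<Longrightarrow> y \<noteq> X v \<Longrightarrow> \<delta> \<le> dist (X v) y"
      using finite_set_avoid[of "X ` V" "X v"] finite_V by blast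
    have "E t = E (X v) + \<sigma> v * isgn (X v - t)" if t: "0 < \<bar>t - X v\<bar>" "\<bar>t - X v\<bar> < \<delta>" for t
    proof -
      have "E t = (\<Sum>u\<in>V. \<sigma> u * isgn (X u - X v) + (if u = v then \<sigma> v * isgn (X v - t) else 0))"
        unfolding E_def
      proof (rule sum.cong[OF refl])
        fix u assume u: "u \<in> V"
        show "\<sigma> u * isgn (X u - t) = \<sigma> u * isgn (X u - X v) + (if u = v then \<sigma> v * isgn (X v - t) else 0)"
        proof (cases "u = v")
          case False
          then have "X u \<noteq> X v" using injX u v by (auto dest: inj_onD)
          then have "\<delta> \<le> \<bar>X v - X u\<bar>" using d(2)[of "X u"] u by (simp add: dist_real_def)
          then have "isgn (X u - t) = isgn (X u - X v)" using t by (auto simp: isgn_def)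
          then show ?thesis using False by simp
        qed simp
      qed
      then show ?thesis using v finite_V by (simp add: sum.distrib E_def)
    qed
    then show ?thesis using d(1) by blast
  qed
  \<comment> \<open>The values of \<open>E\<close> next to \<open>X v\<close> are
    \<open>E (X v) + \<sigma> v\<close> on the left and \<open>E (X v) - \<sigma> v\<close> on the
    right, so one of the sides gives \<open>E (X v) + k\<close>.\<close>
  have side: ?thesis if v: "v \<in> V" and E: "int (card V mod 2) = E (X v) + k" and k: "k = 1 \<or> k = - 1" for v k
  proof -
    obtain \<delta> where d: "\<delta> > 0" "\<And>t. 0 < \<bar>t - X v\<bar> \<Longrightarrow> \<bar>t - X v\<bar> < \<delta> \<Longrightarrow> E t = E (X v) + \<sigma> v * isgn (X v - t)"
      using near[OF v] by blast
    show ?thesis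
    proof (cases "\<sigma> v = k")
      case True
      show ?thesis by (rule finish[of "X v - \<delta>" "X v"]) (use d True E in \<open>auto simp: isgn_def\<close>)
    next
      case False
      then have "\<sigma> v = - k" using pm[OF v] k by auto
      then show ?thesis by (intro finish[of "X v" "X v + \<delta>"]) (use d E in \<open>auto simp: isgn_def\<close>)
    qed
  qed
  define D where "D = sum \<sigma> V"
  have parity: "even (D - int (card V))"
  proof -
    have "D - int (card V) = (\<Sum>v\<in>V. \<sigma> v - 1)" by (simp add: D_def sum_subtractf)
    moreover have "even (\<Sum>v\<in>V. \<sigma> v - 1)" by (rule dvd_sum) (use pm in force)
    ultimately show ?thesis by simp
  qed
  define \<epsilon> where "\<epsilon> = int (card V mod 2)"
  have e: "\<epsilon> = 0 \<or> \<epsilon> = 1" unfolding \<epsilon>_def by auto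
  have "even (\<epsilon> - int (card V))" unfolding \<epsilon>_def by (simp add: zmod_int even_iff_mod_2_eq_zero[of "int (card V)"])
  then have De: "even (D - \<epsilon>)" using parity by simp
  show ?thesis
  proof (cases "D = 0")
    case True
    \<comment> \<open>To the left of all \<open>X v\<close> the value of \<open>E\<close> is
      \<open>D\<close>, which is already balanced.\<close>
    define m where "m = Min (X ` V)"
    have m: "m \<le> X v" if "v \<in> V" for v using that finite_V by (simp add: m_def)
    have "E t = D" if "t < m" for t
      unfolding E_def D_def
    proof (rule sum.cong[OF refl])
      fix v assume "v \<in> V"
      then show "\<sigma> v * isgn (X v - t) = \<sigma> v" using m[of v] that by (simp add: isgn_def)
    qed
    moreover have "\<epsilon> = 0" using De e True by auto
    ultimately show ?thesis using True by (intro finish[of "m - 1" m]) (simp_all add: \<epsilon>_def)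
  next
    case False
    \<comment> \<open>At the jump found below, \<open>E\<close> has the value
      \<open>t - 1 = 1 - \<epsilon>\<close>, which differs by 1 from the desired
      \<open>\<epsilon>\<close>.\<close>
    define t where "t = 2 - \<epsilon>"
    have t1: "1 \<le> t" using e by (auto simp: t_def)
    have pt: "even (D - t)" using De by (simp add: t_def)
    have tD: "t \<le> \<bar>D\<bar>"
    proof (cases "\<epsilon> = 1")
      case True
      then show ?thesis using False by (simp add: t_def)
    next
      case z: False
      then have "even D" using e De by auto
      then have "D \<noteq> 1" "D \<noteq> - 1" by auto
      then show ?thesis using False z e by (auto simp: t_def)
    qed
    have "\<exists>v\<in>V. (\<Sum>u\<in>V. \<sigma> u * isgn (X u - X v)) = t - 1"
      by (rule sign_sum_attains[OF finite_V injX pm t1 tD[unfolded D_def] pt[unfolded D_def]])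
    then obtain v where v: "v \<in> V" "E (X v) = t - 1" unfolding E_def by blast
    have "2 * \<epsilon> - 1 = 1 \<or> 2 * \<epsilon> - 1 = - 1" using e by auto
    moreover have "int (card V mod 2) = E (X v) + (2 * \<epsilon> - 1)" unfolding v(2) t_def \<epsilon>_def by simp
    ultimately show ?thesis using side[OF v(1)] by blast
  qed
qed

section \<open>The crossing number\<close>

theorem theorem4:
  fixes V :: "(real^3) set" and n :: nat
  assumes "n \<ge> 3" and "finite V" and "card V = n"
    and "V \<subseteq> sphere 0 1" and "general_position V"
  shows "real (cr V) \<ge>
           1 / 4 * real (n div 2) * real ((n - 1) div 2) * real ((n - 2) div 2) * real ((n - 3) div 2)
       \<and> (coneighborly V \<longrightarrow> real (cr V) =
           1 / 4 * real (n div 2) * real ((n - 1) div 2) * real ((n - 2) div 2) * real ((n - 3) div 2))"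
proof -
  have vc: "vector_config V" using assms by (intro general_position_config) auto
  interpret unit_config V
    by (intro unit_config.intro vc unit_config_axioms.intro) (use assms(4) in auto)
  \<comment> \<open>Besides the vectors of \<open>V\<close>, these are the finitely many vectors to
    which \<open>N\<close> must not be orthogonal.\<close>
  define Quad where "Quad = (\<lambda>(a, b, c, d). cross3 (cross3 a b) (cross3 c d))
    ` {(a, b, c, d) \<in> V \<times> V \<times> V \<times> V. distinct [a, b, c, d]}"
  have quad_nz: "cross3 (cross3 a b) (cross3 c d) \<noteq> 0"
    if V: "a \<in> V" "b \<in> V" "c \<in> V" "d \<in> V" and dist: "distinct [a, b, c, d]" for a b c d
  proof -
    have "cross3 (cross3 (cross3 a b) (cross3 c d)) d = det3 a b d *\<^sub>R cross3 c d"
      unfolding cross3_cross3 by (simp add: Cross3.left_diff_distrib cross_mult_left)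
    moreover have "det3 a b d \<noteq> 0" "cross3 c d \<noteq> 0" using det3_nz cross3_nz V dist by auto
    ultimately show ?thesis by (metis cross_zero_left scaleR_eq_0_iff)
  qed
  have "\<exists>N. (\<forall>w\<in>V \<union> Quad. N \<bullet> w \<noteq> 0) \<and> (\<Sum>v\<in>V. isgn (N \<bullet> v)) = int (card V mod 2)"
  proof (rule exists_balanced_generic[OF vc])
    have "{(a, b, c, d) \<in> V \<times> V \<times> V \<times> V. distinct [a, b, c, d]} \<subseteq> V \<times> V \<times> V \<times> V" by blast
    then have "finite Quad" unfolding Quad_def using assms(2) by (meson finite_SigmaI finite_imageI finite_subset)
    then show "finite (V \<union> Quad)" using assms(2) by simp
    have "0 \<notin> V" using unit by fastforce
    moreover have "0 \<notin> Quad"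
    proof
      assume "0 \<in> Quad"
      then obtain a b c d where "a \<in> V" "b \<in> V" "c \<in> V" "d \<in> V" "distinct [a, b, c, d]"
        "cross3 (cross3 a b) (cross3 c d) = 0" unfolding Quad_def by auto
      then show False using quad_nz by blast
    qed
    ultimately show "0 \<notin> V \<union> Quad" by simp
    show "V \<noteq> {}" using assms(1,3) by auto
  qed auto
  then obtain N where N: "\<And>w. w \<in> V \<union> Quad \<Longrightarrow> N \<bullet> w \<noteq> 0"
    and bal: "(\<Sum>v\<in>V. isgn (N \<bullet> v)) = int (n mod 2)" using assms(3) by blast
  interpret coloured_config V N
  proof
    fix a b c d assume V: "a \<in> V" "b \<in> V" "c \<in> V" "d \<in> V" "distinct [a, b, c, d]"
    have "cross3 (cross3 a b) (cross3 c d) \<in> Quad"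
      unfolding Quad_def by (rule image_eqI[of _ _ "(a, b, c, d)"]) (use V in simp_all)
    then show "N \<bullet> cross3 (cross3 a b) (cross3 c d) \<noteq> 0" by (intro N UnI2)
  qed (use N in auto)
  define \<epsilon> where "\<epsilon> = int (n mod 2)"
  define Q where "Q = (\<Sum>(a, b)\<in>off_diagonal. weight (a, b) * ((imbalance V a b)\<^sup>2 - \<epsilon>))"
  define Z where "Z = int (n div 2) * int ((n - 1) div 2) * int ((n - 2) div 2) * int ((n - 3) div 2)"
  \<comment> \<open>The factor 64 is the 8 of \<open>crossing_identity\<close> times the 8
    quadruples per crossing. Since \<open>bal\<close> makes the colour sum equal to
    \<open>\<epsilon>\<close>, \<open>hill_constant\<close> applies.\<close>
  have main: "64 * int (cr V) = 16 * Z + 2 * Q"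
  proof -
    have "8 * (8 * int (cr V)) = 16 * int (n div 2) * int ((n - 1) div 2) * int ((n - 2) div 2) * int ((n - 3) div 2) + 2 * Q"
      unfolding eight_cr crossing_identity[of \<epsilon>] bal assms(3) \<epsilon>_def[symmetric] Q_def[symmetric]
        hill_constant[OF refl \<epsilon>_def assms(1), symmetric] ..
    then show ?thesis by (simp add: Z_def)
  qed
  have Q0: "0 \<le> Q"
    unfolding Q_def by (rule weighted_square_sum_nonneg) (simp add: \<epsilon>_def assms(3) zmod_int)
  have Q_eq: "Q = 0" if cn: "coneighborly V"
    unfolding Q_def
  proof (rule sum.neutral, clarify)
    fix a b assume ab: "(a, b) \<in> off_diagonal"
    have V: "a \<in> V" "b \<in> V" "a \<noteq> b" using ab by (auto simp: off_diagonal_def)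
    have le: "\<bar>imbalance V a b\<bar> \<le> \<epsilon>" using coneighborly_imbalance[OF vc cn V] assms(3) by (simp add: \<epsilon>_def)
    have e: "\<epsilon> = 0 \<or> \<epsilon> = 1" unfolding \<epsilon>_def by auto
    have "even (imbalance V a b - int n)" using even_imbalance[OF V] assms(3) by simp
    moreover have "even (\<epsilon> - int n)" unfolding \<epsilon>_def by (simp add: zmod_int even_iff_mod_2_eq_zero[of "int n"])
    ultimately have "even (imbalance V a b - \<epsilon>)" by simp
    \<comment> \<open>By parity the imbalance attains its bound \<open>\<epsilon>\<close> in
      absolute value, so every term of \<open>Q\<close> vanishes whatever its weight.\<close>
    then have "\<epsilon> = 1 \<Longrightarrow> imbalance V a b \<noteq> 0" by auto
    then have "\<bar>imbalance V a b\<bar> = \<epsilon>" using le e by auto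
    then have "(imbalance V a b)\<^sup>2 = \<epsilon>\<^sup>2" by (metis power2_abs)
    then show "weight (a, b) * ((imbalance V a b)\<^sup>2 - \<epsilon>) = 0" using e by auto
  qed
  have Z: "1 / 4 * real (n div 2) * real ((n - 1) div 2) * real ((n - 2) div 2) * real ((n - 3) div 2) = real_of_int Z / 4"
    by (simp add: Z_def)
  have "64 * real (cr V) = 16 * real_of_int Z + 2 * real_of_int Q"
    using arg_cong[OF main, of real_of_int] by simp
  then have cr: "real (cr V) = real_of_int Z / 4 + real_of_int Q / 32" by simp
  have "real_of_int Q \<ge> 0" using Q0 by simp
  then show ?thesis unfolding Z cr using Q_eq by auto
qed

end
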